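(* Let $k$ be a field of positive characteristic $p\neq 2,3$, let $\mathfrak{g}=\mathfrak{g}_0\oplus\mathfrak{g}_1$ be a finite-dimensional Lie superalgebra over $k$ such that $\mathfrak{g}_0$ is a three-dimensional simple Lie algebra and $\{\mathfrak{g}_1,\mathfrak{g}_1\}\neq\{0\}$, and let $K$ be the Killing form of $\mathfrak{g}_0$. (a) The Lie superalgebra $\mathfrak{g}$ is restricted. (b) The $[p]$-map on $\mathfrak{g}_0$ satisfies $$x^{[p]}=\Big(\frac{K(x,x)}{2}\Big)^{\frac{p-1}{2}}x\qquad\forall x\in\mathfrak{g}_0.$$ (c) If $\mathfrak{g}_1=(\mathfrak{g}_0\oplus k)\oplus\mathcal{Z}(\mathfrak{g})$ (in the sense described in the context), then the $[2p]$-map on $\mathfrak{g}_1$ satisfies $$(x+\lambda)^{[2p]}=\lambda^p\Big(\frac{K(x,x)}{2}\Big)^{\frac{p-1}{2}}x\qquad\forall x+\lambda\in\mathfrak{g}_0\oplus k\subset\mathfrak{g}_1,$$ where the right-hand side is understood as an even element of $\mathfrak{g}$. (d) If $\mathfrak{g}\cong\mathfrak{osp}_k(1|2)\oplus\mathcal{Z}(\mathfrak{g})$, then the $[2p]$-map on $\mathfrak{g}_1$ is trivial (identically zero).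
   Context: A Lie superalgebra over $k$ is a $\mathbb{Z}_2$-graded vector space $\mathfrak{g}=\mathfrak{g}_0\oplus\mathfrak{g}_1$ with a bilinear bracket $\{\ ,\ \}$ such that $\{\mathfrak{g}_\alpha,\mathfrak{g}_\beta\}\subseteq\mathfrak{g}_{\alpha+\beta}$, $\{x,y\}=-(-1)^{|x||y|}\{y,x\}$, and $(-1)^{|x||z|}\{x,\{y,z\}\}+(-1)^{|y||x|}\{y,\{z,x\}\}+(-1)^{|z||y|}\{z,\{x,y\}\}=0$ for all homogeneous $x,y,z$. Its centre is $\mathcal{Z}(\mathfrak{g})=\{x\in\mathfrak{g}\mid\{x,y\}=0\ \forall y\in\mathfrak{g}\}$. A Lie superalgebra $\mathfrak{g}$ over a field of characteristic $p>3$ is restricted if $\mathfrak{g}_0$ is a restricted Lie algebra with a $[p]$-map $x\mapsto x^{[p]}$ and $\mathfrak{g}_1$ is a restricted representation of $\mathfrak{g}_0$, i.e. $x^{[p]}$ acts on $\mathfrak{g}_1$ as the $p$-th power of the action of $x$, for all $x\in\mathfrak{g}_0$. The $[2p]$-map $\mathfrak{g}_1\to\mathfrak{g}_0$ is then given by $x^{[2p]}=\big(\tfrac12\{x,x\}\big)^{[p]}$ for $x\in\mathfrak{g}_1$. "$\mathfrak{g}_1=(\mathfrak{g}_0\oplus k)\oplus\mathcal{Z}(\mathfrak{g})$" means: as a representation of $\mathfrak{g}_0$, $\mathfrak{g}_1$ is identified with the direct sum of the adjoint representation $\mathfrak{g}_0$, a one-dimensional trivial representation $k$, and $\mathcal{Z}(\mathfrak{g})$,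 and the only non-trivial brackets on $\mathfrak{g}_1$ are $\{v,\lambda\}=\{\lambda,v\}=\lambda v$ for $v\in\mathfrak{g}_0\subset\mathfrak{g}_1$, $\lambda\in k\subset\mathfrak{g}_1$, where the right-hand side is an element of the even part $\mathfrak{g}_0$. $\mathfrak{osp}_k(1|2)$ denotes the Lie superalgebra with even part $\mathfrak{sl}(2,k)$, odd part the standard representation $k^2$, and bracket on the odd part given by $$\{(a,b),(c,d)\}=\begin{pmatrix}-(ad+bc)&2ac\\-2bd&ad+bc\end{pmatrix}.$$ *)

theory Defs
  imports
    "HOL-Analysis.Analysis"
    "HOL-Computational_Algebra.Polynomial"
    "HOL-Library.Z2"
begin

text \<open>A \<open>\<int>\<^sub>2\<close>-graded space with a bracket. The degrees are elements of the two-element field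
  \<^typ>\<open>bit\<close>, so degree arithmetic is arithmetic in \<^typ>\<open>bit\<close>. The graded pieces are subspaces of
  an ambient vector space, and only their sum (the carrier) matters.\<close>

record ('k, 'v) salg =
  scl :: "'k \<Rightarrow> 'v \<Rightarrow> 'v"
  gr :: "bit \<Rightarrow> 'v set"
  brk :: "'v \<Rightarrow> 'v \<Rightarrow> 'v"

definition carr :: "('k, 'v::ab_group_add) salg \<Rightarrow> 'v set" where
  "carr L = {x + y | x y. x \<in> gr L 0 \<and> y \<in> gr L 1}"

text \<open>\<open>(-1)\<^sup>e\<close> for a degree \<open>e\<close>.\<close>
definition ksgn :: "bit \<Rightarrow> 'k::field" where
  "ksgn e = (if e = 1 then - 1 else 1)"

locale lie_superalgebra = vector_space "scl L"
  for L :: "('k::field, 'v::ab_group_add) salg" +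
  assumes subspace_gr: "subspace (gr L i)"
    and direct_sum: "gr L 0 \<inter> gr L 1 = {0}"
    and brk_add_left: "\<lbrakk>x \<in> carr L; y \<in> carr L; z \<in> carr L\<rbrakk> \<Longrightarrow> brk L (x + y) z = brk L x z + brk L y z"
    and brk_add_right: "\<lbrakk>x \<in> carr L; y \<in> carr L; z \<in> carr L\<rbrakk> \<Longrightarrow> brk L x (y + z) = brk L x y + brk L x z"
    and brk_scl_left: "\<lbrakk>x \<in> carr L; y \<in> carr L\<rbrakk> \<Longrightarrow> brk L (scl L c x) y = scl L c (brk L x y)"
    and brk_scl_right: "\<lbrakk>x \<in> carr L; y \<in> carr L\<rbrakk> \<Longrightarrow> brk L x (scl L c y) = scl L c (brk L x y)"
    and brk_degree: "\<lbrakk>x \<in> gr L i; y \<in> gr L j\<rbrakk> \<Longrightarrow> brk L x y \<in> gr L (i + j)"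
    and brk_antisym: "\<lbrakk>x \<in> gr L i; y \<in> gr L j\<rbrakk> \<Longrightarrow> brk L x y = - scl L (ksgn (i * j)) (brk L y x)"
    and brk_jacobi: "\<lbrakk>x \<in> gr L i; y \<in> gr L j; z \<in> gr L l\<rbrakk> \<Longrightarrow>
        scl L (ksgn (i * l)) (brk L x (brk L y z))
      + scl L (ksgn (j * i)) (brk L y (brk L z x))
      + scl L (ksgn (l * j)) (brk L z (brk L x y)) = 0"

definition finite_dim :: "('k::field \<Rightarrow> 'v::ab_group_add \<Rightarrow> 'v) \<Rightarrow> 'v set \<Rightarrow> bool" where
  "finite_dim s V \<longleftrightarrow> (\<exists>B. finite B \<and> B \<subseteq> V \<and> module.span s B = V)"

definition centre :: "('k, 'v::ab_group_add) salg \<Rightarrow> 'v set" where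
  "centre L = {x \<in> carr L. \<forall>y \<in> carr L. brk L x y = 0}"

definition simple_lie :: "('k::field \<Rightarrow> 'v::ab_group_add \<Rightarrow> 'v) \<Rightarrow> ('v \<Rightarrow> 'v \<Rightarrow> 'v) \<Rightarrow> 'v set \<Rightarrow> bool" where
  "simple_lie s br V \<longleftrightarrow>
     (\<exists>x\<in>V. \<exists>y\<in>V. br x y \<noteq> 0) \<and>
     (\<forall>I. module.subspace s I \<and> I \<subseteq> V \<and> (\<forall>x\<in>V. \<forall>y\<in>I. br x y \<in> I) \<longrightarrow> I = {0} \<or> I = V)"

text \<open>The trace of a linear endomorphism of a finite-dimensional subspace \<open>V\<close>; it does not depend
  on the chosen basis.\<close>
definition trace_on :: "('k::field \<Rightarrow> 'v::ab_group_add \<Rightarrow> 'v) \<Rightarrow> 'v set \<Rightarrow> ('v \<Rightarrow> 'v) \<Rightarrow> 'k" where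
  "trace_on s V f =
     (let B = (SOME B. \<not> module.dependent s B \<and> module.span s B = V)
      in \<Sum>b\<in>B. module.representation s B (f b) b)"

definition killing_form ::
    "('k::field \<Rightarrow> 'v::ab_group_add \<Rightarrow> 'v) \<Rightarrow> ('v \<Rightarrow> 'v \<Rightarrow> 'v) \<Rightarrow> 'v set \<Rightarrow> 'v \<Rightarrow> 'v \<Rightarrow> 'k" where
  "killing_form s br V x y = trace_on s V (\<lambda>z. br x (br y z))"

text \<open>Jacobson's terms \<open>s\<^sub>i(x, y)\<close>: the coefficient of \<open>t\<^sup>i\<^sup>-\<^sup>1\<close> in \<open>(ad (t x + y))\<^sup>p\<^sup>-\<^sup>1 (x)\<close> is
  \<open>i s\<^sub>i(x, y)\<close>. Here \<^typ>\<open>'v poly\<close> plays the role of \<open>V \<otimes> k[t]\<close>.\<close>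
definition ad_pencil :: "('v::ab_group_add \<Rightarrow> 'v \<Rightarrow> 'v) \<Rightarrow> 'v \<Rightarrow> 'v \<Rightarrow> 'v poly \<Rightarrow> 'v poly" where
  "ad_pencil br x y q = pCons 0 (map_poly (br x) q) + map_poly (br y) q"

definition jacobson_term ::
    "('k::field \<Rightarrow> 'v::ab_group_add \<Rightarrow> 'v) \<Rightarrow> ('v \<Rightarrow> 'v \<Rightarrow> 'v) \<Rightarrow> nat \<Rightarrow> 'v \<Rightarrow> 'v \<Rightarrow> 'v" where
  "jacobson_term s br i x y =
     s (inverse (of_nat i)) (coeff ((ad_pencil br x y ^^ (CHAR('k) - 1)) [:x:]) (i - 1))"

text \<open>\<open>P\<close> is a \<open>[p]\<close>-map on the Lie algebra \<open>V\<close>, where \<open>p = CHAR('k)\<close>.\<close>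
definition p_map ::
    "('k::field \<Rightarrow> 'v::ab_group_add \<Rightarrow> 'v) \<Rightarrow> ('v \<Rightarrow> 'v \<Rightarrow> 'v) \<Rightarrow> 'v set \<Rightarrow> ('v \<Rightarrow> 'v) \<Rightarrow> bool" where
  "p_map s br V P \<longleftrightarrow>
     (\<forall>x\<in>V. P x \<in> V) \<and>
     (\<forall>x\<in>V. \<forall>y\<in>V. br (P x) y = (br x ^^ CHAR('k)) y) \<and>
     (\<forall>c. \<forall>x\<in>V. P (s c x) = s (c ^ CHAR('k)) (P x)) \<and>
     (\<forall>x\<in>V. \<forall>y\<in>V. P (x + y) = P x + P y + (\<Sum>i = 1..<CHAR('k). jacobson_term s br i x y))"

text \<open>\<open>P\<close> is a \<open>[p]\<close>-map on the even part for which the odd part is a restricted representation.\<close>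
definition restricted_structure :: "('k::field, 'v::ab_group_add) salg \<Rightarrow> ('v \<Rightarrow> 'v) \<Rightarrow> bool" where
  "restricted_structure L P \<longleftrightarrow>
     p_map (scl L) (brk L) (gr L 0) P \<and>
     (\<forall>x\<in>gr L 0. \<forall>y\<in>gr L 1. brk L (P x) y = (brk L x ^^ CHAR('k)) y)"

definition restricted :: "('k::field, 'v::ab_group_add) salg \<Rightarrow> bool" where
  "restricted L \<longleftrightarrow> CHAR('k) > 3 \<and> lie_superalgebra L \<and> (\<exists>P. restricted_structure L P)"

definition two_p_map :: "('k::field, 'v::ab_group_add) salg \<Rightarrow> ('v \<Rightarrow> 'v) \<Rightarrow> 'v \<Rightarrow> 'v" where
  "two_p_map L P x = P (scl L (1 / 2) (brk L x x))"

text \<open>\<open>\<Phi>\<close> identifies the direct sum of the adjoint representation, the trivial representation \<open>k\<close>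
  and \<open>\<Z>(L)\<close> with the odd part of \<open>L\<close>, as representations of the even part, and the brackets of
  odd elements are the bilinear extension of \<open>{v, a} = {a, v} = a v\<close>, all other brackets of
  summands being zero.\<close>
definition adjoint_type ::
    "('k::field, 'v::ab_group_add) salg \<Rightarrow> ('v \<times> 'k \<times> 'v \<Rightarrow> 'v) \<Rightarrow> bool" where
  "adjoint_type L \<Phi> \<longleftrightarrow>
     bij_betw \<Phi> (gr L 0 \<times> UNIV \<times> centre L) (gr L 1) \<and>
     (\<forall>v\<in>gr L 0. \<forall>w\<in>gr L 0. \<forall>a b. \<forall>z\<in>centre L. \<forall>u\<in>centre L.
        \<Phi> (v + w, a + b, z + u) = \<Phi> (v, a, z) + \<Phi> (w, b, u)) \<and>
     (\<forall>c. \<forall>v\<in>gr L 0. \<forall>a. \<forall>z\<in>centre L.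
        \<Phi> (scl L c v, c * a, scl L c z) = scl L c (\<Phi> (v, a, z))) \<and>
     (\<forall>x\<in>gr L 0. \<forall>v\<in>gr L 0. \<forall>a. \<forall>z\<in>centre L.
        brk L x (\<Phi> (v, a, z)) = \<Phi> (brk L x v, 0, brk L x z)) \<and>
     (\<forall>v\<in>gr L 0. \<forall>w\<in>gr L 0. \<forall>a b. \<forall>z\<in>centre L. \<forall>u\<in>centre L.
        brk L (\<Phi> (v, a, z)) (\<Phi> (w, b, u)) = scl L b v + scl L a w)"

definition centre_salg :: "('k, 'v::ab_group_add) salg \<Rightarrow> ('k, 'v) salg" where
  "centre_salg L = \<lparr>scl = scl L, gr = (\<lambda>i. centre L \<inter> gr L i), brk = brk L\<rparr>"

definition dsum_salg :: "('k, 'a) salg \<Rightarrow> ('k, 'b) salg \<Rightarrow> ('k, 'a \<times> 'b) salg" where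
  "dsum_salg A B =
     \<lparr>scl = (\<lambda>c (a, b). (scl A c a, scl B c b)),
      gr = (\<lambda>i. gr A i \<times> gr B i),
      brk = (\<lambda>(a, b) (a', b'). (brk A a a', brk B b b'))\<rparr>"

definition iso_salg :: "('k, 'a::ab_group_add) salg \<Rightarrow> ('k, 'b::ab_group_add) salg \<Rightarrow> bool" where
  "iso_salg A B \<longleftrightarrow>
     (\<exists>f. bij_betw f (carr A) (carr B) \<and>
          (\<forall>i. f ` gr A i = gr B i) \<and>
          (\<forall>x\<in>carr A. \<forall>y\<in>carr A. f (x + y) = f x + f y) \<and>
          (\<forall>c. \<forall>x\<in>carr A. f (scl A c x) = scl B c (f x)) \<and>
          (\<forall>x\<in>carr A. \<forall>y\<in>carr A. f (brk A x y) = brk B (f x) (f y)))"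

definition osp_odd_brk :: "'k::field^2 \<Rightarrow> 'k^2 \<Rightarrow> 'k^2^2" where
  "osp_odd_brk v w =
     (let a = v $ 1; b = v $ 2; c = w $ 1; d = w $ 2 in
      vector [vector [- (a * d + b * c), 2 * a * c],
              vector [- (2 * b * d), a * d + b * c]])"

text \<open>A pair \<open>(X, v)\<close> is the sum of the even element \<open>X\<close> (a traceless matrix) and the odd
  element \<open>v\<close>; by super-antisymmetry the bracket of \<open>v\<close> and \<open>Y\<close> is \<open>- Y v\<close>.\<close>
definition osp12 :: "('k::field, ('k^2^2) \<times> ('k^2)) salg" where
  "osp12 =
     \<lparr>scl = (\<lambda>c (X, v). (\<chi> i j. c * X $ i $ j, c *s v)),
      gr = (\<lambda>i. if i = 0 then {X. trace X = 0} \<times> {0} else {0} \<times> UNIV),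
      brk = (\<lambda>(X, v) (Y, w). (X ** Y - Y ** X + osp_odd_brk v w, X *v w - Y *v v))\<rparr>"

end

theory Submission
  imports Defs "HOL-Computational_Algebra.Formal_Power_Series"
begin

text \<open>Put \<open>c(x) = K(x, x) / 2\<close>. In a three-dimensional simple Lie algebra \<open>(ad x)\<^sup>2 y\<close> differs from
  \<open>c(x) y\<close> by a multiple of \<open>x\<close>, so \<open>(ad x)\<^sup>3 = c(x) ad x\<close> and \<open>(ad x)\<^sup>p = ad (x\<^sup>[\<^sup>p\<^sup>])\<close> with
  \<open>x\<^sup>[\<^sup>p\<^sup>] = c(x)\<^bsup>(p-1)/2\<^esup> x\<close>. As the centre is zero, this is the only candidate for a \<open>[p]\<close>-map, and by
  Jacobson's formula it is one. The formula also shows that the even elements \<open>x\<close> for which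
  \<open>(ad x)\<^sup>p = ad (x\<^sup>[\<^sup>p\<^sup>])\<close> holds on the odd part form a subspace. It contains the squares
  \<open>[u, u] / 2\<close> of odd elements \<open>u\<close>, and these span the even part, which is simple.\<close>

section \<open>Jacobson's formula in a ring of prime characteristic\<close>

definition commutator :: "'a::ring \<Rightarrow> 'a \<Rightarrow> 'a" where
  "commutator a b = a * b - b * a"

text \<open>Left and right multiplication by \<open>a\<close> commute, so this is the binomial
  theorem for a power of their difference; the induction step is Pascal's rule.\<close>

lemma commutator_funpow:
  fixes a b :: "'a::ring_1"
  shows "(commutator a ^^ n) b = (\<Sum>j\<le>n. of_int ((- 1) ^ j * int (n choose j)) * (a ^ (n - j) * b * a ^ j))"
proof (induction n)
  case 0
  show ?case by simp
next
  case (Suc n)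
  define m :: "nat \<Rightarrow> 'a" where "m j = a ^ (Suc n - j) * b * a ^ j" for j
  define c :: "nat \<Rightarrow> nat \<Rightarrow> 'a" where "c n j = of_int ((- 1) ^ j * int (n choose j))" for n j
  have com: "x * (c n j * y) = c n j * (x * y)" for x y :: 'a and n j
    unfolding c_def by (metis (no_types) mult.assoc mult_of_int_commute)
  have c_Suc: "c (Suc n) (Suc j) = c n (Suc j) - c n j" for j
    unfolding c_def of_int_diff[symmetric] by (simp add: algebra_simps)
  have left: "a * (\<Sum>j\<le>n. c n j * (a ^ (n - j) * b * a ^ j)) = (\<Sum>j\<le>Suc n. c n j * m j)"
  proof -
    have "a * (\<Sum>j\<le>n. c n j * (a ^ (n - j) * b * a ^ j)) = (\<Sum>j\<le>n. c n j * m j)"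
      unfolding sum_distrib_left
      by (intro sum.cong refl) (simp add: com m_def Suc_diff_le mult.assoc)
    also have "\<dots> = (\<Sum>j\<le>Suc n. c n j * m j)"
      by (simp add: c_def binomial_eq_0)
    finally show ?thesis .
  qed
  have right: "(\<Sum>j\<le>n. c n j * (a ^ (n - j) * b * a ^ j)) * a = (\<Sum>j\<le>n. c n j * m (Suc j))"
    unfolding sum_distrib_right
    by (intro sum.cong refl) (simp add: m_def mult.assoc flip: power_Suc2)
  let ?S = "\<Sum>j\<le>n. c n j * (a ^ (n - j) * b * a ^ j)"
  have "(commutator a ^^ Suc n) b = a * ?S - ?S * a"
    unfolding funpow.simps o_apply Suc.IH c_def by (simp only: commutator_def)
  also have "\<dots> = (\<Sum>j\<le>Suc n. c n j * m j) - (\<Sum>j\<le>n. c n j * m (Suc j))"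
    by (simp only: left right)
  also have "\<dots> = c n 0 * m 0 + (\<Sum>j\<le>n. (c n (Suc j) - c n j) * m (Suc j))"
    by (subst sum.atMost_Suc_shift) (simp add: sum_subtractf algebra_simps)
  also have "\<dots> = c (Suc n) 0 * m 0 + (\<Sum>j\<le>n. c (Suc n) (Suc j) * m (Suc j))"
    by (simp only: c_Suc) (simp add: c_def)
  also have "\<dots> = (\<Sum>j\<le>Suc n. c (Suc n) j * m j)"
    by (subst sum.atMost_Suc_shift) simp
  finally show ?case
    unfolding c_def m_def .
qed

text \<open>For \<open>0 < i < p\<close> the prime \<open>p\<close> divides
  \<open>p choose i\<close>, so by Pascal's rule neighbouring entries of row \<open>p - 1\<close>
  are opposite modulo \<open>p\<close>. They alternate starting from 1, and the sign
  \<open>(- 1) ^ j\<close> cancels this.\<close>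

lemma binomial_pred_prime_char:
  assumes "prime p" and p: "of_nat p = (0::'a::ring_1)" and "j < p"
  shows "of_int ((- 1) ^ j * int ((p - 1) choose j)) = (1::'a)"
  using \<open>j < p\<close>
proof (induction j)
  case 0
  show ?case by simp
next
  case (Suc j)
  have "p dvd p choose Suc j"
    using assms(1) Suc.prems by (intro dvd_choose_prime) (auto simp: prime_gt_0_nat)
  then have "of_nat (p choose Suc j) = (0::'a)"
    using p by (auto elim!: dvdE)
  moreover have "p choose Suc j = ((p - 1) choose j) + ((p - 1) choose Suc j)"
    using Suc.prems by (cases p) auto
  ultimately have "of_int (int ((p - 1) choose Suc j)) = - of_int (int ((p - 1) choose j)) + (0::'a)"
    by (simp add: eq_neg_iff_add_eq_0 add.commute)
  with Suc show ?case
    by (simp)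
qed

text \<open>With all coefficients equal to 1, the expansion is the ordered sum that the Leibniz rule
  produces for the derivative of a p-th power. This coincidence drives Jacobson's formula.\<close>

lemma commutator_funpow_prime_char:
  fixes a b :: "'a::ring_1"
  assumes "prime p" and "of_nat p = (0::'a)"
  shows "(commutator a ^^ (p - 1)) b = (\<Sum>j<p. a ^ (p - 1 - j) * b * a ^ j)"
proof -
  have "{..p - 1} = {..<p}"
    using prime_gt_0_nat[OF assms(1)] by auto
  then show ?thesis
    unfolding commutator_funpow
    by (intro sum.cong) (simp_all only: binomial_pred_prime_char[OF assms] lessThan_iff mult_1_left)
qed

text \<open>The Leibniz rule with the order of factors kept, since \<open>f\<close> and
  \<open>fps_deriv f\<close> need not commute.\<close>

lemma fps_deriv_power_noncommutative:
  fixes f :: "'a::ring_1 fps"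
  shows "fps_deriv (f ^ n) = (\<Sum>j<n. f ^ (n - 1 - j) * fps_deriv f * f ^ j)"
proof (induction n)
  case 0
  show ?case by simp
next
  case (Suc n)
  have "f * (\<Sum>j<n. f ^ (n - 1 - j) * fps_deriv f * f ^ j) = (\<Sum>j<n. f ^ (n - j) * fps_deriv f * f ^ j)"
    unfolding sum_distrib_left
    by (intro sum.cong refl)
       (metis One_nat_def Suc_diff_Suc diff_Suc_eq_diff_pred lessThan_iff mult.assoc power_Suc)
  then show ?case
    using Suc by (simp add: add.commute)
qed

text \<open>\<open>Z\<close> is the pencil \<open>t x + y\<close> with a central variable
  \<open>t\<close>. Its n-th power is a polynomial of degree at most \<open>n\<close>, so the sum of
  its coefficients is its value at \<open>t = 1\<close>.\<close>

lemma pencil_power_nth: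
  fixes x y :: "'a::ring_1"
  defines "Z \<equiv> fps_X * fps_const x + fps_const y"
  shows "fps_nth (Z ^ n) 0 = y ^ n"
    and "fps_nth (Z ^ n) n = x ^ n"
    and "(\<Sum>i\<le>n. fps_nth (Z ^ n) i) = (x + y) ^ n"
proof -
  have Z_nth: "fps_nth (Z * f) i = (if i = 0 then 0 else x * fps_nth f (i - 1)) + y * fps_nth f i" for f i
    unfolding Z_def by (simp add: distrib_right mult.assoc)
  show "fps_nth (Z ^ n) 0 = y ^ n"
    by (induction n) (simp_all add: Z_nth del: fps_mult_nth_0)
  have van: "fps_nth (Z ^ n) i = 0" if "i > n" for i n
    using that by (induction n arbitrary: i) (simp_all add: Z_nth)
  show "fps_nth (Z ^ n) n = x ^ n"
    by (induction n) (simp_all add: Z_nth van)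
  show "(\<Sum>i\<le>n. fps_nth (Z ^ n) i) = (x + y) ^ n"
  proof (induction n)
    case 0
    show ?case by simp
  next
    case (Suc n)
    have "(\<Sum>i\<le>Suc n. fps_nth (Z ^ Suc n) i)
        = (\<Sum>i\<le>Suc n. (if i = 0 then 0 else x * fps_nth (Z ^ n) (i - 1))) + (\<Sum>i\<le>Suc n. y * fps_nth (Z ^ n) i)"
      by (simp add: Z_nth sum.distrib)
    also have "(\<Sum>i\<le>Suc n. (if i = 0 then 0 else x * fps_nth (Z ^ n) (i - 1))) = x * (\<Sum>i\<le>n. fps_nth (Z ^ n) i)"
      by (subst sum.atMost_Suc_shift) (simp add: sum_distrib_left)
    also have "(\<Sum>i\<le>Suc n. y * fps_nth (Z ^ n) i) = y * (\<Sum>i\<le>n. fps_nth (Z ^ n) i)"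
      by (simp add: van sum_distrib_left)
    finally show ?case
      by (simp add: Suc.IH distrib_right)
  qed
qed

text \<open>The outer coefficients of \<open>Z ^ p\<close> are \<open>y ^ p\<close> and
  \<open>x ^ p\<close>, and the value at \<open>t = 1\<close> is \<open>(x + y) ^ p\<close>. The
  inner ones are found by differentiating in \<open>t\<close>: the derivative of
  \<open>Z ^ p\<close> is the commutator with \<open>Z\<close>, iterated \<open>p - 1\<close> times
  on \<open>x\<close>, an expression in Lie brackets only.\<close>

theorem jacobson_formula_ring:
  fixes x y :: "'a::ring_1"
  assumes "prime p" and char: "of_nat p = (0::'a)"
  defines "Z \<equiv> fps_X * fps_const x + fps_const y"
  shows "(x + y) ^ p = x ^ p + y ^ p + (\<Sum>i = 1..<p. fps_nth (Z ^ p) i)"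
    and "i > 0 \<Longrightarrow> of_nat i * fps_nth (Z ^ p) i = fps_nth ((commutator Z ^^ (p - 1)) (fps_const x)) (i - 1)"
proof -
  have p: "p > 0"
    using assms(1) by (rule prime_gt_0_nat)
  then have "{..p} = insert 0 (insert p {1..<p})"
    by auto
  then have "(x + y) ^ p = (\<Sum>i\<in>insert 0 (insert p {1..<p}). fps_nth (Z ^ p) i)"
    unfolding Z_def using pencil_power_nth(3)[of x y p] by simp
  also have "\<dots> = y ^ p + (x ^ p + (\<Sum>i = 1..<p. fps_nth (Z ^ p) i))"
    using p unfolding Z_def by (simp add: pencil_power_nth(1,2))
  finally show "(x + y) ^ p = x ^ p + y ^ p + (\<Sum>i = 1..<p. fps_nth (Z ^ p) i)"
    by (simp add: ac_simps)
  have "of_nat p = (0 :: 'a fps)"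
    using char by (simp flip: fps_of_nat)
  moreover have "fps_deriv Z = fps_const x"
    by (simp add: Z_def)
  ultimately have "fps_deriv (Z ^ p) = (commutator Z ^^ (p - 1)) (fps_const x)"
    using assms(1) by (simp only: fps_deriv_power_noncommutative commutator_funpow_prime_char)
  from this[symmetric]
  show "i > 0 \<Longrightarrow> of_nat i * fps_nth (Z ^ p) i = fps_nth ((commutator Z ^^ (p - 1)) (fps_const x)) (i - 1)"
    by simp
qed

section \<open>The ring of additive endomorphisms\<close>

text \<open>Additive endomorphisms of \<open>'v \<times> 'k\<close> rather than of \<open>'v\<close>: the second factor only makes the ring
  nontrivial, as the class \<^class>\<open>ring_1\<close> demands.\<close>

typedef (overloaded) ('v::ab_group_add, 'k::"{ab_group_add, zero_neq_one}") endo =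
  "{f :: 'v \<times> 'k \<Rightarrow> 'v \<times> 'k. \<forall>x y. f (x + y) = f x + f y}"
  morphisms app Endo
  by (rule exI[of _ "\<lambda>_. 0"]) simp

setup_lifting type_definition_endo

lemma app_add: "app f (x + y) = app f x + app f y"
  using app[of f] by blast

lemma endo_eqI: "(\<And>z. app f z = app g z) \<Longrightarrow> f = g"
  by (simp add: app_inject[symmetric] fun_eq_iff del: split_paired_All)

instantiation endo :: (ab_group_add, "{ab_group_add, zero_neq_one}") ring_1
begin

lift_definition zero_endo :: "('a, 'b) endo" is "\<lambda>_. 0" by simp
lift_definition one_endo :: "('a, 'b) endo" is "\<lambda>x. x" by simp
lift_definition plus_endo :: "('a, 'b) endo \<Rightarrow> ('a, 'b) endo \<Rightarrow> ('a, 'b) endo" is "\<lambda>f g x. f x + g x"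
  by (simp add: algebra_simps)
lift_definition minus_endo :: "('a, 'b) endo \<Rightarrow> ('a, 'b) endo \<Rightarrow> ('a, 'b) endo" is "\<lambda>f g x. f x - g x"
  by (simp add: algebra_simps)
lift_definition uminus_endo :: "('a, 'b) endo \<Rightarrow> ('a, 'b) endo" is "\<lambda>f x. - f x"
  by simp
lift_definition times_endo :: "('a, 'b) endo \<Rightarrow> ('a, 'b) endo \<Rightarrow> ('a, 'b) endo" is "\<lambda>f g x. f (g x)"
  by simp

lemmas app_simps = zero_endo.rep_eq one_endo.rep_eq plus_endo.rep_eq minus_endo.rep_eq
  uminus_endo.rep_eq times_endo.rep_eq

instance
proof
  fix a b c :: "('a, 'b) endo"
  show "(0 :: ('a, 'b) endo) \<noteq> 1"
  proof
    assume "(0 :: ('a, 'b) endo) = 1"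
    then have "app (0 :: ('a, 'b) endo) (0, 1) = app (1 :: ('a, 'b) endo) (0, 1)"
      by simp
    then show False
      by (simp add: app_simps zero_prod_def)
  qed
qed (rule endo_eqI, simp add: app_simps app_add algebra_simps)+

end

lemma app_of_nat: "app (of_nat n * f) z = (\<Sum>_<n. app f z)"
  by (induction n) (simp_all add: distrib_right app_simps add.commute)

section \<open>Three-dimensional simple Lie algebras\<close>

locale lie_algebra_on = vector_space s
  for s :: "'k::field \<Rightarrow> 'v::ab_group_add \<Rightarrow> 'v" +
  fixes V :: "'v set" and br :: "'v \<Rightarrow> 'v \<Rightarrow> 'v"
  assumes subspace_V: "subspace V"
    and br_closed: "\<lbrakk>x \<in> V; y \<in> V\<rbrakk> \<Longrightarrow> br x y \<in> V"
    and br_add_left: "\<lbrakk>x \<in> V; y \<in> V; z \<in> V\<rbrakk> \<Longrightarrow> br (x + y) z = br x z + br y z"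
    and br_add_right: "\<lbrakk>x \<in> V; y \<in> V; z \<in> V\<rbrakk> \<Longrightarrow> br x (y + z) = br x y + br x z"
    and br_scale_left: "\<lbrakk>x \<in> V; y \<in> V\<rbrakk> \<Longrightarrow> br (s c x) y = s c (br x y)"
    and br_scale_right: "\<lbrakk>x \<in> V; y \<in> V\<rbrakk> \<Longrightarrow> br x (s c y) = s c (br x y)"
    and br_self: "x \<in> V \<Longrightarrow> br x x = 0"
    and br_jacobi: "\<lbrakk>x \<in> V; y \<in> V; z \<in> V\<rbrakk> \<Longrightarrow> br x (br y z) + br y (br z x) + br z (br x y) = 0"
begin

lemmas V_intros = subspace_0[OF subspace_V] subspace_add[OF subspace_V] subspace_diff[OF subspace_V]
  subspace_neg[OF subspace_V] subspace_scale[OF subspace_V] subspace_sum[OF subspace_V] br_closed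

lemma br_zero: "x \<in> V \<Longrightarrow> br 0 x = 0" "x \<in> V \<Longrightarrow> br x 0 = 0"
  using br_scale_left[of x x 0] br_scale_right[of x x 0] by simp_all

lemma br_diff_right: "\<lbrakk>x \<in> V; y \<in> V; z \<in> V\<rbrakk> \<Longrightarrow> br x (y - z) = br x y - br x z"
  using br_add_right[of x "y - z" z] by (simp add: V_intros)

lemma br_swap: "\<lbrakk>x \<in> V; y \<in> V\<rbrakk> \<Longrightarrow> br y x = - br x y"
  using br_self[of x] br_self[of y] br_self[of "x + y"]
  by (simp add: br_add_left br_add_right V_intros eq_neg_iff_add_eq_0 add.commute)

lemma simple_centreless:
  assumes "simple_lie s br V" and "x \<in> V" and "\<And>y. y \<in> V \<Longrightarrow> br x y = 0"
  shows "x = 0"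
proof -
  define I where "I = {x \<in> V. \<forall>y\<in>V. br x y = 0}"
  have "subspace I"
    by (auto simp: I_def subspace_def V_intros br_zero br_add_left br_scale_left)
  moreover have "br y z \<in> I" if "y \<in> V" "z \<in> I" for y z
    using that br_swap[of z y] by (auto simp: I_def V_intros br_zero)
  ultimately have "I = {0} \<or> I = V"
    using assms(1) unfolding simple_lie_def by (auto simp: I_def)
  moreover have "I \<noteq> V"
    using assms(1) by (auto simp: simple_lie_def I_def)
  ultimately show ?thesis
    using assms(2,3) by (auto simp: I_def)
qed

lemma simple_perfect:
  assumes "simple_lie s br V"
  shows "span {br x y | x y. x \<in> V \<and> y \<in> V} = V"
proof -
  let ?I = "span {br x y | x y. x \<in> V \<and> y \<in> V}"
  have sub: "?I \<subseteq> V"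
    by (rule span_minimal) (auto simp: V_intros subspace_V)
  moreover have "br x y \<in> ?I" if "x \<in> V" "y \<in> ?I" for x y
    using that sub by (auto intro!: span_base)
  ultimately have "?I = {0} \<or> ?I = V"
    using assms unfolding simple_lie_def by auto
  moreover have "?I \<noteq> {0}"
    using assms unfolding simple_lie_def by (metis (mono_tags, lifting) mem_Collect_eq singletonD span_base)
  ultimately show ?thesis
    by blast
qed

end

text \<open>A nonzero coefficient would express one vector through the other two, and two vectors
  cannot span a space of dimension 3.\<close>

lemma (in vector_space) dim3_spanning_independent:
  assumes "V \<subseteq> span {u, v, w}" and "dim V = 3" and "scale a u + scale b v + scale c w = 0"
  shows "a = 0" "b = 0" "c = 0"
proof -
  have main: "a = 0" if "V \<subseteq> span {u, v, w}" "scale a u + scale b v + scale c w = 0" for u v w a b c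
  proof (rule ccontr)
    assume "a \<noteq> 0"
    have "scale a u = - scale b v - scale c w"
      using that(2) by (simp add: algebra_simps eq_neg_iff_add_eq_0)
    then have "scale a u \<in> span {v, w}"
      by (simp add: span_diff span_neg span_scale span_base)
    then have "scale (1 / a) (scale a u) \<in> span {v, w}"
      by (rule span_scale)
    then have "u \<in> span {v, w}"
      using \<open>a \<noteq> 0\<close> by simp
    then have "dim V \<le> card {v, w}"
      using that(1) by (intro dim_le_card) (simp_all add: span_redundant)
    also have "\<dots> \<le> 2"
      by (simp add: card_insert_if)
    finally show False
      using assms(2) by simp
  qed
  show "a = 0"
    using assms main by blast
  show "b = 0"
    using assms main[of v u w b a c] by (simp add: insert_commute add.commute)
  show "c = 0"
    using assms main[of w v u c b a] by (simp add: insert_commute add.commute add.left_commute)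
qed

locale simple_lie_algebra_dim3 = lie_algebra_on +
  assumes simple: "simple_lie s br V" and dim3: "dim V = 3"
begin

text \<open>In coordinates the bracket is \<open>x, y \<mapsto> A (x \<times> y)\<close>; the Jacobi identity says that \<open>A\<close> is
  symmetric, and \<open>\<beta>(x, y) = - x \<bullet> adj(A) y\<close>.\<close>

lemma double_bracket_form:
  obtains \<beta> :: "'b \<Rightarrow> 'b \<Rightarrow> 'a"
  where "\<And>x y z. \<lbrakk>y \<in> V; z \<in> V\<rbrakk> \<Longrightarrow> \<beta> x (y + z) = \<beta> x y + \<beta> x z"
    and "\<And>x y a. y \<in> V \<Longrightarrow> \<beta> x (s a y) = a * \<beta> x y"
    and "\<And>x y. \<lbrakk>x \<in> V; y \<in> V\<rbrakk> \<Longrightarrow> br x (br x y) = s (\<beta> x x) y - s (\<beta> x y) x"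
proof -
  obtain B where B: "B \<subseteq> V" "independent B" "V \<subseteq> span B" "card B = 3"
    using basis_exists[of V] dim3 by metis
  obtain e1 e2 e3 where B_eq: "B = {e1, e2, e3}" and dist: "e1 \<noteq> e2" "e2 \<noteq> e3" "e1 \<noteq> e3"
    using B(4) by (metis card_3_iff)
  have eV: "e1 \<in> V" "e2 \<in> V" "e3 \<in> V"
    using B(1) B_eq by auto
  define E where "E a b c = s a e1 + s b e2 + s c e3" for a b c
  define X where "X x = representation B x e1" for x
  define Y where "Y x = representation B x e2" for x
  define Z where "Z x = representation B x e3" for x
  have EV [simp]: "E a b c \<in> V" for a b c
    unfolding E_def using eV by (simp add: V_intros)
  have E_XYZ: "E (X x) (Y x) (Z x) = x" if "x \<in> V" for x
    using sum_representation_eq[of B x B] B that dist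
    by (auto simp: E_def X_def Y_def Z_def B_eq add.assoc)
  have coord_add: "X (x + y) = X x + X y" "Y (x + y) = Y x + Y y" "Z (x + y) = Z x + Z y"
    if "x \<in> V" "y \<in> V" for x y
    using B(2) that[THEN subsetD[OF B(3)]] by (simp_all add: X_def Y_def Z_def representation_add)
  have coord_scale: "X (s a x) = a * X x" "Y (s a x) = a * Y x" "Z (s a x) = a * Z x"
    if "x \<in> V" for x a
    using B(2) that[THEN subsetD[OF B(3)]] by (simp_all add: X_def Y_def Z_def representation_scale)
  have E_add: "E a b c + E a' b' c' = E (a + a') (b + b') (c + c')" for a b c a' b' c'
    by (simp add: E_def scale_left_distrib)
  have E_diff: "E a b c - E a' b' c' = E (a - a') (b - b') (c - c')" for a b c a' b' c'
    by (simp add: E_def scale_left_diff_distrib)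
  have E_scale: "s t (E a b c) = E (t * a) (t * b) (t * c)" for t a b c
    by (simp add: E_def scale_right_distrib)
  \<comment> \<open>Brackets of basis vectors in cyclic order; their coordinates \<open>a11\<close>,
    ..., \<open>a33\<close> form the matrix of the bracket.\<close>
  define f1 where "f1 = br e2 e3"
  define f2 where "f2 = br e3 e1"
  define f3 where "f3 = br e1 e2"
  have fV: "f1 \<in> V" "f2 \<in> V" "f3 \<in> V"
    using eV by (simp_all add: f1_def f2_def f3_def br_closed)
  have br_e: "br e1 e1 = 0" "br e2 e2 = 0" "br e3 e3 = 0"
    "br e2 e3 = f1" "br e3 e2 = - f1" "br e3 e1 = f2" "br e1 e3 = - f2" "br e1 e2 = f3" "br e2 e1 = - f3"
    using eV br_swap[of e2 e3] br_swap[of e3 e1] br_swap[of e1 e2]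
    by (simp_all add: br_self f1_def f2_def f3_def)
  have br_E: "br (E a b c) (E a' b' c')
      = s (b * c' - c * b') f1 + s (c * a' - a * c') f2 + s (a * b' - b * a') f3" for a b c a' b' c'
    unfolding E_def using eV
    by (simp add: br_add_left br_add_right br_scale_left br_scale_right V_intros br_e
        scale_left_diff_distrib scale_right_distrib scale_minus_right algebra_simps)
  \<comment> \<open>A simple algebra is spanned by its brackets, and these are combinations of
    \<open>f1\<close>, \<open>f2\<close>, \<open>f3\<close>. As the dimension is 3, the three
    vectors are independent.\<close>
  have span_f: "V \<subseteq> span {f1, f2, f3}"
  proof -
    have "br x y \<in> span {f1, f2, f3}" if "x \<in> V" "y \<in> V" for x y
    proof -
      have "br (E (X x) (Y x) (Z x)) (E (X y) (Y y) (Z y)) \<in> span {f1, f2, f3}"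
        unfolding br_E by (intro span_add span_scale span_base) auto
      then show ?thesis
        using that by (simp add: E_XYZ)
    qed
    then have "span {br x y | x y. x \<in> V \<and> y \<in> V} \<subseteq> span {f1, f2, f3}"
      by (intro span_minimal subspace_span) auto
    then show ?thesis
      using simple_perfect[OF simple] by simp
  qed
  define a11 a12 a13 a21 a22 a23 a31 a32 a33 where A:
    "a11 = X f1" "a12 = Y f1" "a13 = Z f1" "a21 = X f2" "a22 = Y f2" "a23 = Z f2"
    "a31 = X f3" "a32 = Y f3" "a33 = Z f3"
  have f_E: "f1 = E a11 a12 a13" "f2 = E a21 a22 a23" "f3 = E a31 a32 a33"
    unfolding A using fV by (simp_all add: E_XYZ)
  have e_E: "e1 = E 1 0 0" "e2 = E 0 1 0" "e3 = E 0 0 1"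
    by (simp_all add: E_def)
  have jac1: "br e1 f1 = s (- a13) f2 + s a12 f3"
    unfolding f_E(1) by (subst e_E(1), subst br_E) simp
  have jac2: "br e2 f2 = s a23 f1 + s (- a21) f3"
    unfolding f_E(2) by (subst e_E(2), subst br_E) simp
  have jac3: "br e3 f3 = s (- a32) f1 + s a31 f2"
    unfolding f_E(3) by (subst e_E(3), subst br_E) simp
  \<comment> \<open>The Jacobi identity on the basis becomes a linear relation among
    \<open>f1\<close>, \<open>f2\<close>, \<open>f3\<close> whose coefficients are differences of
    opposite off-diagonal entries, so the matrix is symmetric.\<close>
  have "br e1 f1 + br e2 f2 + br e3 f3 = 0"
    using br_jacobi[of e1 e2 e3] eV by (simp add: br_e)
  then have "s (a23 - a32) f1 + s (a31 - a13) f2 + s (a12 - a21) f3 = 0"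
    unfolding jac1 jac2 jac3 by (simp add: scale_left_diff_distrib algebra_simps)
  from dim3_spanning_independent[OF span_f dim3 this]
  have sym: "a32 = a23" "a31 = a13" "a21 = a12"
    by simp_all
  have br_E': "br (E a b c) (E a' b' c') =
      E ((b * c' - c * b') * a11 + (c * a' - a * c') * a12 + (a * b' - b * a') * a13)
        ((b * c' - c * b') * a12 + (c * a' - a * c') * a22 + (a * b' - b * a') * a23)
        ((b * c' - c * b') * a13 + (c * a' - a * c') * a23 + (a * b' - b * a') * a33)" for a b c a' b' c'
    unfolding br_E f_E E_scale E_add sym ..
  define \<beta> where "\<beta> x y = - ((a22 * a33 - a23 * a23) * X x * X y + (a11 * a33 - a13 * a13) * Y x * Y y
     + (a11 * a22 - a12 * a12) * Z x * Z y
     + (a13 * a23 - a12 * a33) * (X x * Y y + Y x * X y)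
     + (a12 * a23 - a13 * a22) * (X x * Z y + Z x * X y)
     + (a12 * a13 - a11 * a23) * (Y x * Z y + Z x * Y y))" for x y
  show thesis
  proof (rule that[of \<beta>])
    show "\<beta> x (y + z) = \<beta> x y + \<beta> x z" if "y \<in> V" "z \<in> V" for x y z
      using that by (simp add: \<beta>_def coord_add algebra_simps)
    show "\<beta> x (s a y) = a * \<beta> x y" if "y \<in> V" for x y a
      using that by (simp add: \<beta>_def coord_scale algebra_simps)
    show "br x (br x y) = s (\<beta> x x) y - s (\<beta> x y) x" if "x \<in> V" "y \<in> V" for x y
    proof -
      have *: "br (E (X x) (Y x) (Z x)) (br (E (X x) (Y x) (Z x)) (E (X y) (Y y) (Z y)))
          = s (\<beta> x x) (E (X y) (Y y) (Z y)) - s (\<beta> x y) (E (X x) (Y x) (Z x))"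
        \<comment> \<open>In coordinates the claim is one polynomial identity per component.\<close>
        unfolding br_E' E_scale E_diff \<beta>_def
        by (intro arg_cong3[where f = E]; algebra)
      then show ?thesis
        using that by (simp add: E_XYZ)
    qed
  qed
qed

text \<open>The square of \<open>ad x\<close> is the scalar \<open>\<beta> x x\<close> on a space of
  dimension 3 minus a map of rank at most one. The traces are \<open>3 * \<beta> x x\<close> and
  \<open>\<beta> x x\<close>.\<close>

lemma killing_form_double_bracket:
  fixes \<beta> :: "'b \<Rightarrow> 'b \<Rightarrow> 'a"
  assumes add: "\<And>x y z. \<lbrakk>y \<in> V; z \<in> V\<rbrakk> \<Longrightarrow> \<beta> x (y + z) = \<beta> x y + \<beta> x z"
    and scale: "\<And>x y a. y \<in> V \<Longrightarrow> \<beta> x (s a y) = a * \<beta> x y"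
    and double: "\<And>x y. \<lbrakk>x \<in> V; y \<in> V\<rbrakk> \<Longrightarrow> br x (br x y) = s (\<beta> x x) y - s (\<beta> x y) x"
    and x: "x \<in> V"
  shows "killing_form s br V x x = 2 * \<beta> x x"
proof -
  \<comment> \<open>The same basis that \<open>trace_on\<close> selects, so that its definition
    unfolds to a sum over \<open>B\<close>.\<close>
  define B where "B = (SOME B. \<not> dependent B \<and> span B = V)"
  have "\<exists>B. \<not> dependent B \<and> span B = V"
    using basis_exists[of V] span_subspace[OF _ _ subspace_V] by metis
  then have B: "independent B" "span B = V"
    unfolding B_def by (metis (mono_tags, lifting) someI_ex)+
  then have card: "card B = 3"
    using dim_eq_card_independent[of B] dim_span[of B] dim3 by simp
  then have fin: "finite B"
    by (metis card.infinite zero_neq_numeral)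
  have BV: "b \<in> V" if "b \<in> B" for b
    using that B(2) span_base by blast
  have "\<beta> x 0 = 0"
    using scale[of x x 0] x by simp
  have \<beta>_sum: "\<beta> x (\<Sum>b\<in>C. g b) = (\<Sum>b\<in>C. \<beta> x (g b))" if "finite C" "\<And>b. b \<in> C \<Longrightarrow> g b \<in> V" for C g
    using that by (induction C rule: finite_induct) (simp_all add: add V_intros \<open>\<beta> x 0 = 0\<close>)
  have "killing_form s br V x x = (\<Sum>b\<in>B. representation B (s (\<beta> x x) b - s (\<beta> x b) x) b)"
    unfolding killing_form_def trace_on_def Let_def B_def[symmetric]
    by (intro sum.cong refl) (simp add: double x BV)
  also have "\<dots> = (\<Sum>b\<in>B. \<beta> x x - representation B x b * \<beta> x b)"
    using B x BV
    by (intro sum.cong refl)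
       (simp add: representation_diff representation_scale V_intros representation_basis)
  also have "\<dots> = 3 * \<beta> x x - \<beta> x (\<Sum>b\<in>B. s (representation B x b) b)"
    using fin BV by (simp add: sum_subtractf card \<beta>_sum scale V_intros)
  also have "(\<Sum>b\<in>B. s (representation B x b) b) = x"
    using B x fin by (intro sum_representation_eq) auto
  finally show ?thesis
    by simp
qed

text \<open>The form \<beta> is eliminated: its diagonal is half the Killing form, and later
  arguments use only that the remaining term is some multiple of \<open>x\<close>.\<close>

lemma double_bracket:
  assumes "(2::'a) \<noteq> 0" and "x \<in> V" and "y \<in> V"
  obtains b where "br x (br x y) = s (killing_form s br V x x / 2) y - s b x"
proof -
  obtain \<beta> where \<beta>: "\<And>x y z. \<lbrakk>y \<in> V; z \<in> V\<rbrakk> \<Longrightarrow> \<beta> x (y + z) = \<beta> x y + \<beta> x z"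
    "\<And>x y a. y \<in> V \<Longrightarrow> \<beta> x (s a y) = a * \<beta> x y"
    "\<And>x y. \<lbrakk>x \<in> V; y \<in> V\<rbrakk> \<Longrightarrow> br x (br x y) = s (\<beta> x x) y - s (\<beta> x y) x"
    by (rule double_bracket_form) blast
  have "killing_form s br V x x / 2 = \<beta> x x"
    using killing_form_double_bracket[of \<beta>, OF \<beta> assms(2)] assms(1) by simp
  with \<beta>(3)[OF assms(2,3)] show thesis
    by (intro that[of "\<beta> x y"]) simp
qed

end

section \<open>Jacobson's formula in a representation\<close>

text \<open>The module is a subspace of the same ambient space as the algebra, so one locale covers
  the adjoint representation and the action of the even part on the whole superalgebra.\<close>

locale lie_representation = lie_algebra_on s V br
  for s :: "'k::field \<Rightarrow> 'v::ab_group_add \<Rightarrow> 'v" and V br +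
  fixes M :: "'v set" and act :: "'v \<Rightarrow> 'v \<Rightarrow> 'v"
  assumes subspace_M: "subspace M"
    and act_closed: "\<lbrakk>x \<in> V; m \<in> M\<rbrakk> \<Longrightarrow> act x m \<in> M"
    and act_add_left: "\<lbrakk>x \<in> V; y \<in> V; m \<in> M\<rbrakk> \<Longrightarrow> act (x + y) m = act x m + act y m"
    and act_add_right: "\<lbrakk>x \<in> V; m \<in> M; n \<in> M\<rbrakk> \<Longrightarrow> act x (m + n) = act x m + act x n"
    and act_scale_left: "\<lbrakk>x \<in> V; m \<in> M\<rbrakk> \<Longrightarrow> act (s c x) m = s c (act x m)"
    and act_scale_right: "\<lbrakk>x \<in> V; m \<in> M\<rbrakk> \<Longrightarrow> act x (s c m) = s c (act x m)"
    and act_bracket: "\<lbrakk>x \<in> V; y \<in> V; m \<in> M\<rbrakk> \<Longrightarrow> act (br x y) m = act x (act y m) - act y (act x m)"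
begin

lemma act_zero: "m \<in> M \<Longrightarrow> act 0 m = 0" "x \<in> V \<Longrightarrow> act x 0 = 0"
  using act_scale_left[of 0 m 0] act_scale_right[of x 0 0] by (simp_all add: V_intros subspace_0[OF subspace_M])

lemma act_diff_left: "\<lbrakk>x \<in> V; y \<in> V; m \<in> M\<rbrakk> \<Longrightarrow> act (x - y) m = act x m - act y m"
  using act_add_left[of "x - y" y m] by (simp add: V_intros)

lemma act_sum_left:
  assumes "\<And>i. i \<in> I \<Longrightarrow> g i \<in> V" and "m \<in> M"
  shows "act (\<Sum>i\<in>I. g i) m = (\<Sum>i\<in>I. act (g i) m)"
  using assms by (induction I rule: infinite_finite_induct) (simp_all add: act_zero act_add_left V_intros)

lemma act_funpow_closed: "\<lbrakk>x \<in> V; m \<in> M\<rbrakk> \<Longrightarrow> (act x ^^ n) m \<in> M"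
  by (induction n) (simp_all add: act_closed)

lemma act_funpow_scale:
  assumes "x \<in> V" and "m \<in> M"
  shows "(act (s c x) ^^ n) m = s (c ^ n) ((act x ^^ n) m)"
proof (induction n)
  case (Suc n)
  then show ?case
    using assms by (simp add: act_scale_left act_scale_right act_funpow_closed V_intros subspace_scale[OF subspace_M])
qed simp

lemma coeff_ad_pencil:
  assumes "x \<in> V" and "y \<in> V"
  shows "coeff (ad_pencil br x y q) i = (if i = 0 then 0 else br x (coeff q (i - 1))) + br y (coeff q i)"
  using assms by (simp add: ad_pencil_def coeff_map_poly br_zero coeff_pCons split: nat.split)

lemma coeff_ad_pencil_funpow_closed:
  assumes "x \<in> V" and "y \<in> V"
  shows "coeff ((ad_pencil br x y ^^ n) [:x:]) i \<in> V"
proof (induction n arbitrary: i)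
  case 0
  show ?case
    using assms by (simp add: coeff_pCons V_intros split: nat.split)
next
  case (Suc n)
  then show ?case
    using assms by (simp add: coeff_ad_pencil V_intros)
qed

lemma jacobson_term_closed: "\<lbrakk>x \<in> V; y \<in> V\<rbrakk> \<Longrightarrow> jacobson_term s br i x y \<in> V"
  by (simp add: jacobson_term_def coeff_ad_pencil_funpow_closed V_intros)

text \<open>Jacobson's formula in the endomorphism ring is applied to the operators of
  \<open>x\<close> and \<open>y\<close>. A representation turns brackets into commutators, so the
  correction terms are the operators of the Jacobson terms computed in the algebra itself.\<close>

theorem act_jacobson:
  assumes prime: "prime CHAR('k)" and x: "x \<in> V" and y: "y \<in> V" and m: "m \<in> M"
  shows "(act (x + y) ^^ CHAR('k)) m = (act x ^^ CHAR('k)) m + (act y ^^ CHAR('k)) m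
    + (\<Sum>i = 1..<CHAR('k). act (jacobson_term s br i x y) m)"
proof -
  interpret vp: vector_space_pair s s ..
  have "Vector_Spaces.linear s s id"
    by (rule linear_id)
  \<comment> \<open>\<open>act\<close> is controlled only on \<open>M\<close>; a linear projection
    \<pi> onto \<open>M\<close> extends each operator to the whole ambient space, as the type
    \<open>endo\<close> requires.\<close>
  then obtain \<pi> where \<pi>_range: "\<pi> ` UNIV \<subseteq> M" and \<pi>_lin: "Vector_Spaces.linear s s \<pi>" and \<pi>_id: "\<And>m. m \<in> M \<Longrightarrow> \<pi> m = m"
    using vp.linear_exists_left_inverse_on[of id M] subspace_M by auto
  have \<pi>M [simp]: "\<pi> v \<in> M" for v
    using \<pi>_range by blast
  interpret \<pi>: Vector_Spaces.linear s s \<pi>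
    by (rule \<pi>_lin)
  define p where "p = CHAR('k)"
  have p: "prime p"
    using prime by (simp add: p_def)
  define \<rho> :: "'v \<Rightarrow> ('v, 'k) endo" where "\<rho> x = Endo (\<lambda>z. (act x (\<pi> (fst z)), 0))" for x
  have app_\<rho>: "app (\<rho> x) z = (act x (\<pi> (fst z)), 0)" if "x \<in> V" for x z
    unfolding \<rho>_def using that
    by (subst Endo_inverse) (auto simp: \<pi>.add act_add_right simp del: split_paired_All)
  have \<rho>_add: "\<rho> (x + y) = \<rho> x + \<rho> y" if "x \<in> V" "y \<in> V" for x y
    by (rule endo_eqI) (use that in \<open>simp add: app_simps app_\<rho> act_add_left V_intros\<close>)
  have \<rho>_zero: "\<rho> 0 = 0"
    by (rule endo_eqI) (simp add: app_simps app_\<rho> act_zero V_intros zero_prod_def)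
  have \<rho>_br: "\<rho> (br x y) = \<rho> x * \<rho> y - \<rho> y * \<rho> x" if "x \<in> V" "y \<in> V" for x y
    by (rule endo_eqI)
       (simp add: that br_closed minus_endo.rep_eq times_endo.rep_eq app_\<rho> act_bracket act_closed \<pi>_id)
  have app_power: "app (\<rho> x ^ n) (m, 0) = ((act x ^^ n) m, 0)" if "x \<in> V" for x n
    using that m by (induction n) (simp_all add: app_simps app_\<rho> \<pi>_id act_funpow_closed)
  \<comment> \<open>Both factors of the underlying group are vector spaces over a field of
    characteristic \<open>p\<close>, so \<open>p\<close> annihilates them.\<close>
  have char: "of_nat p = (0 :: ('v, 'k) endo)"
  proof (rule endo_eqI)
    fix z :: "'v \<times> 'k"
    have "(\<Sum>_<p. z) = ((\<Sum>_<p. fst z), (\<Sum>_<p. snd z))"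
      by (simp add: prod_eq_iff fst_sum snd_sum)
    also have "(\<Sum>_<p. fst z) = s (\<Sum>_<p. 1) (fst z)"
      unfolding scale_sum_left by simp
    finally show "app (of_nat p) z = app 0 z"
      using app_of_nat[of p 1 z] by (simp add: app_simps p_def zero_prod_def)
  qed
  define Z where "Z = fps_X * fps_const (\<rho> x) + fps_const (\<rho> y)"
  have commutator_nth: "fps_nth (commutator Z f) i
      = (if i = 0 then 0 else \<rho> x * fps_nth f (i - 1) - fps_nth f (i - 1) * \<rho> x)
        + (\<rho> y * fps_nth f i - fps_nth f i * \<rho> y)" for f i
  proof -
    have "f * (fps_X * fps_const (\<rho> x)) = fps_X * (f * fps_const (\<rho> x))"
      by (metis fps_mult_fps_X_commute mult.assoc)
    then show ?thesis
      by (simp add: commutator_def Z_def distrib_left distrib_right mult.assoc)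
  qed
  \<comment> \<open>Under \<rho>, the commutator with \<open>Z\<close> corresponds to
    \<open>ad_pencil\<close>, coefficient by coefficient.\<close>
  have pencil: "fps_nth ((commutator Z ^^ n) (fps_const (\<rho> x))) i
      = \<rho> (coeff ((ad_pencil br x y ^^ n) [:x:]) i)" for n i
  proof (induction n arbitrary: i)
    case 0
    show ?case
      by (simp add: coeff_pCons \<rho>_zero split: nat.split)
  next
    case (Suc n)
    show ?case
      using x y
      by (simp add: commutator_nth Suc.IH coeff_ad_pencil coeff_ad_pencil_funpow_closed \<rho>_add \<rho>_br \<rho>_zero V_intros)
  qed
  have term_eq: "fst (app (fps_nth (Z ^ p) i) (m, 0)) = act (jacobson_term s br i x y) m"
    if i: "i \<in> {1..<p}" for i
  proof -
    define w where "w = coeff ((ad_pencil br x y ^^ (p - 1)) [:x:]) (i - 1)"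
    define t where "t = fst (app (fps_nth (Z ^ p) i) (m, 0))"
    have w: "w \<in> V"
      using x y by (simp add: w_def coeff_ad_pencil_funpow_closed)
    have "of_nat i * fps_nth (Z ^ p) i = \<rho> w"
      using jacobson_formula_ring(2)[OF p char, of i "\<rho> x" "\<rho> y"] i
      by (simp add: pencil w_def flip: Z_def)
    then have "(\<Sum>_<i. t) = act w m"
      using app_of_nat[of i "fps_nth (Z ^ p) i" "(m, 0)"] w m
      by (simp add: app_\<rho> \<pi>_id t_def prod_eq_iff fst_sum)
    moreover have "(\<Sum>_<i. t) = s (of_nat i) t"
      using scale_sum_left[of "\<lambda>_. 1" "{..<i}" t] by simp
    \<comment> \<open>As \<open>0 < i < p\<close>, the factor \<open>i\<close> can be divided out;
      this is the inverse in \<open>jacobson_term\<close>.\<close>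
    moreover have "of_nat i \<noteq> (0::'k)"
      using i by (auto simp: of_nat_eq_0_iff_char_dvd p_def dest: dvd_imp_le)
    ultimately have "t = s (inverse (of_nat i)) (act w m)"
      by (metis left_inverse scale_one scale_scale)
    also have "\<dots> = act (jacobson_term s br i x y) m"
      unfolding jacobson_term_def p_def[symmetric] w_def[symmetric] using w m by (simp add: act_scale_left)
    finally show ?thesis
      by (simp only: t_def)
  qed
  have app_sum: "fst (app (\<Sum>i\<in>I. g i) z) = (\<Sum>i\<in>I. fst (app (g i) z))"
    for g :: "nat \<Rightarrow> ('v, 'k) endo" and I z
    by (induction I rule: infinite_finite_induct) (simp_all add: app_simps)
  have "\<rho> (x + y) ^ p = \<rho> x ^ p + \<rho> y ^ p + (\<Sum>i = 1..<p. fps_nth (Z ^ p) i)"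
    unfolding Z_def \<rho>_add[OF x y] by (rule jacobson_formula_ring(1)[OF p char])
  then have "fst (app (\<rho> (x + y) ^ p) (m, 0))
      = fst (app (\<rho> x ^ p) (m, 0)) + fst (app (\<rho> y ^ p) (m, 0)) + (\<Sum>i = 1..<p. fst (app (fps_nth (Z ^ p) i) (m, 0)))"
    by (simp add: app_simps app_sum)
  then show ?thesis
    using x y by (simp add: app_power term_eq V_intros flip: p_def)
qed

end

section \<open>[p]-maps on centreless Lie algebras and odd powers of ad x\<close>

context lie_algebra_on
begin

lemma adjoint_representation: "lie_representation s V br V br"
proof unfold_locales
  fix x y z assume xyz: "x \<in> V" "y \<in> V" "z \<in> V"
  have "br x (br y z) + br y (br z x) + br z (br x y) = 0"
    using xyz by (rule br_jacobi)
  moreover have "br y (br z x) = - br y (br x z)" "br z (br x y) = - br (br x y) z"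
    using xyz br_swap[of x z] br_swap[of "br x y" z] br_scale_right[of y "br x z" "- 1"]
    by (simp_all add: V_intros)
  ultimately show "br (br x y) z = br x (br y z) - br y (br x z)"
    by (simp add: algebra_simps eq_neg_iff_add_eq_0)
qed (simp_all add: subspace_V V_intros br_add_left br_add_right br_scale_left br_scale_right)

text \<open>Without a centre an element is determined by its adjoint operator. Semilinearity and the
  sum rule can therefore be checked on operators, where \<open>P x\<close> becomes a p-th power and
  Jacobson's formula applies.\<close>

lemma p_map_if_centreless:
  assumes prime: "prime CHAR('k)"
    and centreless: "\<And>x. \<lbrakk>x \<in> V; \<And>y. y \<in> V \<Longrightarrow> br x y = 0\<rbrakk> \<Longrightarrow> x = 0"
    and P_closed: "\<And>x. x \<in> V \<Longrightarrow> P x \<in> V"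
    and P: "\<And>x y. \<lbrakk>x \<in> V; y \<in> V\<rbrakk> \<Longrightarrow> br (P x) y = (br x ^^ CHAR('k)) y"
  shows "p_map s br V P"
proof -
  interpret ad: lie_representation s V br V br
    by (rule adjoint_representation)
  have eqI: "x = y" if "x \<in> V" "y \<in> V" "\<And>z. z \<in> V \<Longrightarrow> br x z = br y z" for x y
    using centreless[of "x - y"] that by (simp add: ad.act_diff_left V_intros)
  show ?thesis
    unfolding p_map_def
  proof (intro conjI ballI allI)
    fix c x assume "x \<in> V"
    then show "P (s c x) = s (c ^ CHAR('k)) (P x)"
      by - (rule eqI; simp add: P P_closed V_intros br_scale_left ad.act_funpow_scale)
  next
    fix x y assume "x \<in> V" "y \<in> V"
    then show "P (x + y) = P x + P y + (\<Sum>i = 1..<CHAR('k). jacobson_term s br i x y)"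
      by - (rule eqI; simp add: P P_closed V_intros br_add_left ad.act_sum_left ad.jacobson_term_closed
          ad.act_jacobson[OF prime])
  qed (simp_all add: P P_closed)
qed

end

context vector_space
begin

text \<open>On the image of \<open>f\<close> the square of \<open>f\<close> is multiplication by
  \<open>c\<close>, so every two applications beyond the first contribute one factor
  \<open>c\<close>.\<close>

lemma funpow_cubic:
  assumes scale: "\<And>c y. y \<in> M \<Longrightarrow> f (scale c y) = scale c (f y)"
    and closed: "\<And>y. y \<in> M \<Longrightarrow> f y \<in> M"
    and cubic: "\<And>y. y \<in> M \<Longrightarrow> f (f (f y)) = scale c (f y)"
    and "odd n" and y: "y \<in> M"
  shows "(f ^^ n) y = scale (c ^ ((n - 1) div 2)) (f y)"
proof -
  have "(f ^^ (2 * k + 1)) y = scale (c ^ k) (f y)" for k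
    by (induction k) (simp_all add: scale closed cubic y mult.commute)
  moreover obtain k where "n = 2 * k + 1"
    using \<open>odd n\<close> by (rule oddE)
  ultimately show ?thesis
    by simp
qed

end

context simple_lie_algebra_dim3
begin

text \<open>One more application of \<open>ad x\<close> to the double bracket kills the multiple of
  \<open>x\<close>, which leaves the cubic relation of \<open>funpow_cubic\<close> with
  \<open>c\<close> half the Killing value.\<close>

lemma br_funpow_char:
  assumes "odd CHAR('a)" and "x \<in> V" and "y \<in> V"
  shows "(br x ^^ CHAR('a)) y = s ((killing_form s br V x x / 2) ^ ((CHAR('a) - 1) div 2)) (br x y)"
proof -
  have two: "(2::'a) \<noteq> 0"
  proof
    assume "(2::'a) = 0"
    then have "CHAR('a) dvd 2"
      using of_nat_eq_0_iff_char_dvd[of 2, where ?'a = 'a] by simp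
    then have "CHAR('a) = 1"
      using assms(1) by (metis dvd_refl prime_nat_iff two_is_prime_nat)
    then show False
      using of_nat_CHAR[where ?'a = 'a] by simp
  qed
  have "br x (br x (br x y)) = s (killing_form s br V x x / 2) (br x y)" if y: "y \<in> V" for y
  proof -
    obtain b where "br x (br x y) = s (killing_form s br V x x / 2) y - s b x"
      using double_bracket[OF two assms(2) y] .
    then show ?thesis
      using assms(2) y by (simp add: br_diff_right V_intros br_scale_right br_self)
  qed
  then show ?thesis
    using assms by (intro funpow_cubic[of V]) (simp_all add: br_scale_right br_closed)
qed

end

section \<open>Lie superalgebras with three-dimensional simple even part\<close>

context lie_superalgebra
begin

lemma gr_subset_carr: "x \<in> gr L i \<Longrightarrow> x \<in> carr L"
  using subspace_0[OF subspace_gr] by (cases i) (force simp: carr_def)+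

lemmas gr_subset_carr' = gr_subset_carr[of _ 0] gr_subset_carr[of _ 1]

lemma gr_zero: "0 \<in> gr L i"
  by (rule subspace_0[OF subspace_gr])

lemma gr_add: "\<lbrakk>x \<in> gr L i; y \<in> gr L i\<rbrakk> \<Longrightarrow> x + y \<in> gr L i"
  by (rule subspace_add[OF subspace_gr])

lemma gr_scale: "x \<in> gr L i \<Longrightarrow> scl L c x \<in> gr L i"
  by (rule subspace_scale[OF subspace_gr])

lemma subspace_carr: "subspace (carr L)"
  unfolding carr_def by (intro subspace_sums subspace_gr)

lemma brk_closed:
  "\<lbrakk>x \<in> gr L 0; y \<in> gr L i\<rbrakk> \<Longrightarrow> brk L x y \<in> gr L i"
  "\<lbrakk>x \<in> gr L 1; y \<in> gr L 0\<rbrakk> \<Longrightarrow> brk L x y \<in> gr L 1"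
  "\<lbrakk>x \<in> gr L 1; y \<in> gr L 1\<rbrakk> \<Longrightarrow> brk L x y \<in> gr L 0"
  using brk_degree[of x 1 y 0] brk_degree[of x 1 y 1] brk_degree[of x 0 y i, unfolded add_0] by simp_all

lemma brk_even_swap: "\<lbrakk>x \<in> gr L 0; y \<in> gr L i\<rbrakk> \<Longrightarrow> brk L y x = - brk L x y"
  using brk_antisym[of y i x 0] by (simp add: ksgn_def)

lemma brk_odd_swap: "\<lbrakk>x \<in> gr L 1; y \<in> gr L 1\<rbrakk> \<Longrightarrow> brk L y x = brk L x y"
  using brk_antisym[of y 1 x 1] by (simp add: ksgn_def)

lemma brk_zero: "x \<in> carr L \<Longrightarrow> brk L 0 x = 0" "x \<in> carr L \<Longrightarrow> brk L x 0 = 0"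
  using brk_scl_left[of x x 0] brk_scl_right[of x x 0] by simp_all

lemma brk_minus_right: "\<lbrakk>x \<in> carr L; y \<in> carr L\<rbrakk> \<Longrightarrow> brk L x (- y) = - brk L x y"
  using brk_scl_right[of x y "- 1"] by simp

lemma brk_diff_right: "\<lbrakk>x \<in> carr L; y \<in> carr L; z \<in> carr L\<rbrakk> \<Longrightarrow> brk L x (y - z) = brk L x y - brk L x z"
  using brk_add_right[of x "y - z" z] by (simp add: subspace_diff[OF subspace_carr])

lemma even_action_bracket:
  assumes x: "x \<in> gr L 0" and y: "y \<in> gr L 0" and m: "m \<in> gr L i"
  shows "brk L (brk L x y) m = brk L x (brk L y m) - brk L y (brk L x m)"
proof -
  have "brk L x (brk L y m) + brk L y (brk L m x) + brk L m (brk L x y) = 0"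
    using brk_jacobi[of x 0 y 0 m i] assms by (simp add: ksgn_def)
  moreover have "brk L y (brk L m x) = - brk L y (brk L x m)"
    using brk_even_swap[OF x m] brk_minus_right[OF gr_subset_carr[OF y] gr_subset_carr[OF brk_closed(1)[OF x m]]]
    by simp
  moreover have "brk L m (brk L x y) = - brk L (brk L x y) m"
    using brk_even_swap[OF brk_closed(1)[OF x y] m] .
  ultimately show ?thesis
    by (simp add: algebra_simps eq_neg_iff_add_eq_0)
qed

text \<open>In even degree super-antisymmetry is ordinary antisymmetry, which yields
  \<open>[x, x] = 0\<close> after division by 2.\<close>

lemma even_lie_algebra:
  assumes "(2::'k) \<noteq> 0"
  shows "lie_algebra_on (scl L) (gr L 0) (brk L)"
proof unfold_locales
  fix x assume "x \<in> gr L 0"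
  then have "brk L x x = - brk L x x"
    by (intro brk_even_swap)
  then have "scl L (1 + 1) (brk L x x) = 0"
    unfolding scale_left_distrib by (simp add: eq_neg_iff_add_eq_0)
  then show "brk L x x = 0"
    using assms by simp
next
  fix x y z assume "x \<in> gr L 0" "y \<in> gr L 0" "z \<in> gr L 0"
  then show "brk L x (brk L y z) + brk L y (brk L z x) + brk L z (brk L x y) = 0"
    using brk_jacobi[of x 0 y 0 z 0] by (simp add: ksgn_def)
qed (simp_all add: subspace_gr brk_closed gr_subset_carr brk_add_left brk_add_right brk_scl_left brk_scl_right)

text \<open>Taking the whole carrier as module treats both parities together. The Jacobi identity is
  given for homogeneous elements, so the module element is split into its components.\<close>

lemma even_representation:
  assumes "(2::'k) \<noteq> 0"
  shows "lie_representation (scl L) (gr L 0) (brk L) (carr L) (brk L)"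
proof -
  interpret even: lie_algebra_on "scl L" "gr L 0" "brk L"
    using assms by (rule even_lie_algebra)
  have decomp: "\<exists>a b. m = a + b \<and> a \<in> gr L 0 \<and> b \<in> gr L 1" if "m \<in> carr L" for m
    using that by (auto simp: carr_def)
  show ?thesis
  proof unfold_locales
    fix x m assume x: "x \<in> gr L 0" and "m \<in> carr L"
    from decomp[OF this(2)] obtain a b where "m = a + b" "a \<in> gr L 0" "b \<in> gr L 1"
      by blast
    moreover have "brk L x a \<in> carr L" "brk L x b \<in> carr L"
      using x \<open>a \<in> gr L 0\<close> \<open>b \<in> gr L 1\<close> brk_closed(1) gr_subset_carr by blast+
    ultimately show "brk L x m \<in> carr L"
      using x by (simp add: brk_add_right gr_subset_carr subspace_add[OF subspace_carr])
  next
    fix x y m assume xy: "x \<in> gr L 0" "y \<in> gr L 0" and "m \<in> carr L"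
    from decomp[OF this(3)] obtain a b where m: "m = a + b" and ab: "a \<in> gr L 0" "b \<in> gr L 1"
      by blast
    have a: "brk L (brk L x y) a = brk L x (brk L y a) - brk L y (brk L x a)"
      using xy ab by (intro even_action_bracket)
    have b: "brk L (brk L x y) b = brk L x (brk L y b) - brk L y (brk L x b)"
      using xy ab by (intro even_action_bracket)
    have "x \<in> carr L" "y \<in> carr L" "a \<in> carr L" "b \<in> carr L" "brk L x y \<in> carr L"
      "brk L x a \<in> carr L" "brk L y a \<in> carr L" "brk L x b \<in> carr L" "brk L y b \<in> carr L"
      using xy ab brk_closed(1) gr_subset_carr by blast+
    then show "brk L (brk L x y) m = brk L x (brk L y m) - brk L y (brk L x m)"
      by (simp add: m brk_add_right a b)
  qed (simp_all add: subspace_carr gr_subset_carr brk_add_left brk_add_right brk_scl_left brk_scl_right)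
qed

text \<open>For odd \<open>u\<close>, the Jacobi identity with \<open>u\<close> taken twice reads
  \<open>[[u, u], z] = 2 [u, [u, z]]\<close>.\<close>

lemma brk_odd_square:
  assumes two: "(2::'k) \<noteq> 0" and u: "u \<in> gr L 1" and z: "z \<in> gr L i"
  shows "brk L (scl L (1 / 2) (brk L u u)) z = brk L u (brk L u z)"
proof -
  have uu: "brk L u u \<in> gr L 0"
    using u by (intro brk_closed)
  have swap: "brk L z (brk L u u) = - brk L (brk L u u) z"
    using uu z by (rule brk_even_swap)
  have "brk L (brk L u u) z = brk L u (brk L u z) + brk L u (brk L u z)"
  \<comment> \<open>The parity of \<open>z\<close> decides the signs in the Jacobi identity and in
    the exchange of \<open>u\<close> and \<open>z\<close>.\<close>
  proof (cases "i = 0")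
    case True
    have "brk L z u = - brk L u z"
      using brk_even_swap[of z u 1] u z True by simp
    moreover have "brk L u z \<in> carr L"
      using u z True brk_closed(2) gr_subset_carr by blast
    ultimately have "brk L u (brk L z u) = - brk L u (brk L u z)"
      using brk_minus_right[OF gr_subset_carr[OF u]] by simp
    then show ?thesis
      using brk_jacobi[of u 1 u 1 z 0] swap u z True by (simp add: ksgn_def)
  next
    case False
    then show ?thesis
      using brk_jacobi[of u 1 u 1 z 1] swap brk_odd_swap[of z u] u z
      by (simp add: ksgn_def algebra_simps eq_neg_iff_add_eq_0)
  qed
  also have "\<dots> = scl L 2 (brk L u (brk L u z))"
    using scale_left_distrib[of 1 1] by simp
  finally show ?thesis
    using uu z two by (simp add: brk_scl_left gr_subset_carr)
qed

text \<open>The Jacobi identity at \<open>u, u, u\<close> has three equal terms, so the bracket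
  vanishes after division by 3.\<close>

lemma brk_odd_cube:
  assumes "(3::'k) \<noteq> 0" and u: "u \<in> gr L 1"
  shows "brk L u (brk L u u) = 0"
proof -
  have "brk L u (brk L u u) + (brk L u (brk L u u) + brk L u (brk L u u)) = 0"
    using brk_jacobi[of u 1 u 1 u 1] u by (simp add: ksgn_def algebra_simps) (metis add.right_inverse)
  moreover have "scl L (1 + (1 + 1)) a = a + (a + a)" for a
    by (simp only: scale_left_distrib scale_one)
  ultimately have "scl L 3 (brk L u (brk L u u)) = 0"
    by simp
  then show ?thesis
    using assms(1) by simp
qed

text \<open>For a sum, \<open>P\<close> and the p-th power of the action on the odd part produce the
  same Jacobson terms, so compatibility passes from \<open>x\<close> and \<open>y\<close> to
  \<open>x + y\<close>. Semilinearity handles scalar multiples.\<close>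

lemma restricted_elements_subspace:
  assumes "prime CHAR('k)" and "(2::'k) \<noteq> 0" and P: "p_map (scl L) (brk L) (gr L 0) P"
  shows "subspace {x \<in> gr L 0. \<forall>m\<in>gr L 1. brk L (P x) m = (brk L x ^^ CHAR('k)) m}"
proof -
  interpret rep: lie_representation "scl L" "gr L 0" "brk L" "carr L" "brk L"
    using assms(2) by (rule even_representation)
  let ?p = "CHAR('k)"
  have P_closed: "P x \<in> gr L 0" if "x \<in> gr L 0" for x
    using P that by (simp add: p_map_def)
  have P_scale: "P (scl L c x) = scl L (c ^ ?p) (P x)" if "x \<in> gr L 0" for c x
    using P that by (simp add: p_map_def)
  have P_add: "P (x + y) = P x + P y + (\<Sum>i = 1..<?p. jacobson_term (scl L) (brk L) i x y)"
    if "x \<in> gr L 0" "y \<in> gr L 0" for x y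
    using P that by (simp add: p_map_def)
  have scale: "brk L (P (scl L c x)) m = (brk L (scl L c x) ^^ ?p) m"
    if "x \<in> gr L 0" "m \<in> gr L 1" "brk L (P x) m = (brk L x ^^ ?p) m" for c x m
    using that by (simp add: P_scale P_closed brk_scl_left gr_subset_carr' rep.act_funpow_scale)
  show ?thesis
    unfolding subspace_def
  proof (intro conjI ballI allI; clarify)
    have "?p > 0"
      using assms(1) by (rule prime_gt_0_nat)
    then have "(brk L 0 ^^ ?p) m = 0" if "m \<in> gr L 1" for m
      using rep.act_funpow_scale[of 0 m ?p 0] that \<open>?p > 0\<close> by (simp add: gr_zero zero_power gr_subset_carr')
    moreover have "P 0 = 0"
      using P_scale[of 0 0] \<open>?p > 0\<close> by (simp add: gr_zero zero_power)
    ultimately show "0 \<in> gr L 0 \<and> (\<forall>m\<in>gr L 1. brk L (P 0) m = (brk L 0 ^^ ?p) m)"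
      by (simp add: gr_zero brk_zero gr_subset_carr')
  next
    fix x y
    assume x: "x \<in> gr L 0" "\<forall>m\<in>gr L 1. brk L (P x) m = (brk L x ^^ ?p) m"
      and y: "y \<in> gr L 0" "\<forall>m\<in>gr L 1. brk L (P y) m = (brk L y ^^ ?p) m"
    have "brk L (P (x + y)) m = (brk L (x + y) ^^ ?p) m" if "m \<in> gr L 1" for m
      using x y that
      by (simp add: P_add P_closed rep.act_add_left rep.act_sum_left rep.jacobson_term_closed rep.V_intros
          gr_subset_carr' rep.act_jacobson[OF assms(1)])
    then show "x + y \<in> gr L 0 \<and> (\<forall>m\<in>gr L 1. brk L (P (x + y)) m = (brk L (x + y) ^^ ?p) m)"
      using x y by (simp add: gr_add)
  next
    fix c x
    assume "x \<in> gr L 0" "\<forall>m\<in>gr L 1. brk L (P x) m = (brk L x ^^ ?p) m"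
    then show "scl L c x \<in> gr L 0 \<and> (\<forall>m\<in>gr L 1. brk L (P (scl L c x)) m = (brk L (scl L c x) ^^ ?p) m)"
      by (simp add: gr_scale scale)
  qed
qed

end

section \<open>Square-zero matrices arising from osp(1|2)\<close>

text \<open>The matrix has trace and determinant zero, so Cayley-Hamilton explains the claim; the
  entries are checked directly.\<close>

lemma osp_odd_brk_square_zero:
  fixes v :: "'k::field^2"
  shows "osp_odd_brk v v ** osp_odd_brk v v = 0"
  by (simp add: vec_eq_iff forall_2 matrix_matrix_mult_def sum_2 osp_odd_brk_def Let_def)

text \<open>\<open>C\<close> is the difference of left and right multiplication by \<open>N\<close>.
  These commute and have square zero, and each term of the cube contains one of them at least
  twice.\<close>

lemma matrix_commutator_cube_zero:
  fixes N Y :: "'k::field^'n^'n"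
  assumes "N ** N = 0"
  defines "C \<equiv> \<lambda>Y. N ** Y - Y ** N"
  shows "C (C (C Y)) = 0"
proof -
  have ldiff: "A ** (B - B') = A ** B - A ** B'" and rdiff: "(B - B') ** A = B ** A - B' ** A"
    for A B B' :: "'k^'n^'n"
    by (simp_all add: matrix_matrix_mult_def vec_eq_iff sum_subtractf algebra_simps)
  \<comment> \<open>The double commutator is -2 times \<open>M\<close>, and \<open>N\<close>
    annihilates \<open>M\<close> from both sides.\<close>
  define M where "M = N ** Y ** N"
  have "N ** M = 0" "M ** N = 0"
    unfolding M_def by (simp_all add: matrix_mul_assoc assms(1)) (simp add: assms(1) flip: matrix_mul_assoc)
  moreover have "C (C Y) = (0 - M) - (M - 0)"
  proof -
    have "C (C Y) = (N ** (N ** Y) - N ** (Y ** N)) - (N ** Y ** N - Y ** N ** N)"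
      by (simp only: C_def ldiff rdiff)
    moreover have "N ** (N ** Y) = 0"
      by (simp add: matrix_mul_assoc assms(1))
    moreover have "Y ** N ** N = 0"
      by (simp add: assms(1) flip: matrix_mul_assoc)
    moreover have "N ** (Y ** N) = M"
      by (simp only: M_def matrix_mul_assoc)
    ultimately show ?thesis
      by (simp only: M_def)
  qed
  ultimately have "C (C (C Y)) = (N ** 0 - 0) - (0 - N ** 0) - ((0 ** N - 0) - (0 - 0 ** N))"
    by (simp only: C_def ldiff rdiff)
  then show ?thesis
    by simp
qed

section \<open>Odd brackets span the even part; the restricted structure\<close>

text \<open>By the Jacobi identity an even element acts on a bracket of odd elements as a
  derivation, so the span is an ideal of the even part, and simplicity applies.\<close>

lemma (in lie_superalgebra) even_eq_span_odd_brackets: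
  assumes simple: "simple_lie (scl L) (brk L) (gr L 0)"
    and nonzero: "span {brk L x y | x y. x \<in> gr L 1 \<and> y \<in> gr L 1} \<noteq> {0}"
  shows "span {brk L x y | x y. x \<in> gr L 1 \<and> y \<in> gr L 1} = gr L 0"
proof -
  let ?G = "{brk L x y | x y. x \<in> gr L 1 \<and> y \<in> gr L 1}"
  have sub: "span ?G \<subseteq> gr L 0"
    by (rule span_minimal) (auto simp: subspace_gr brk_closed)
  have "brk L a z \<in> span ?G" if a: "a \<in> gr L 0" and z: "z \<in> span ?G" for a z
  proof -
    \<comment> \<open>The condition on \<open>z\<close> is linear, so generators suffice. Membership
      in the even part is included because bilinearity of the bracket is available only on the
      carrier.\<close>
    have "?G \<subseteq> {z \<in> gr L 0. brk L a z \<in> span ?G}"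
    proof clarify
      fix x y assume xy: "x \<in> gr L 1" "y \<in> gr L 1"
      have "brk L x (brk L y a) = - brk L x (brk L a y)"
        using brk_even_swap[OF a xy(2)] brk_minus_right[OF gr_subset_carr[OF xy(1)] gr_subset_carr[OF brk_closed(1)[OF a xy(2)]]]
        by simp
      then have "brk L a (brk L x y) = brk L x (brk L a y) + brk L y (brk L a x)"
        using brk_jacobi[of a 0 x 1 y 1] a xy by (simp add: ksgn_def algebra_simps)
      also have "\<dots> \<in> span ?G"
        using a xy brk_closed(1) by (intro span_add span_base) blast+
      finally show "brk L x y \<in> gr L 0 \<and> brk L a (brk L x y) \<in> span ?G"
        using xy by (simp add: brk_closed)
    qed
    moreover have "subspace {z \<in> gr L 0. brk L a z \<in> span ?G}"
      using a unfolding subspace_def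
      by (auto simp: gr_zero gr_add gr_scale brk_zero brk_add_right brk_scl_right gr_subset_carr'
          span_zero span_add span_scale)
    ultimately have "span ?G \<subseteq> {z \<in> gr L 0. brk L a z \<in> span ?G}"
      by (rule span_minimal)
    then show ?thesis
      using z by blast
  qed
  then show ?thesis
    using simple sub nonzero unfolding simple_lie_def by (metis (no_types, lifting) subspace_span)
qed

locale lie_superalgebra_simple_dim3 = lie_superalgebra +
  assumes prime: "prime CHAR('a)" and char: "CHAR('a) > 3"
    and simple: "simple_lie (scl L) (brk L) (gr L 0)" and dim3: "dim (gr L 0) = 3"
    and odd_brk: "span {brk L x y | x y. x \<in> gr L 1 \<and> y \<in> gr L 1} \<noteq> {0}"
begin

lemma two: "(2::'a) \<noteq> 0" and three: "(3::'a) \<noteq> 0"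
  using of_nat_eq_0_iff_char_dvd[of 2, where ?'a = 'a] of_nat_eq_0_iff_char_dvd[of 3, where ?'a = 'a] char
  by (auto dest!: dvd_imp_le)

lemma odd_char: "odd CHAR('a)"
  using prime char by (intro prime_odd_nat) auto

sublocale even: simple_lie_algebra_dim3 "scl L" "gr L 0" "brk L"
  using even_lie_algebra[OF two] simple dim3
  by (simp add: simple_lie_algebra_dim3_def simple_lie_algebra_dim3_axioms_def)

abbreviation K :: "'b \<Rightarrow> 'b \<Rightarrow> 'a" where
  "K \<equiv> killing_form (scl L) (brk L) (gr L 0)"

definition pth_power :: "'b \<Rightarrow> 'b" where
  "pth_power x = scl L ((K x x / 2) ^ ((CHAR('a) - 1) div 2)) x"

lemma pth_power_closed: "x \<in> gr L 0 \<Longrightarrow> pth_power x \<in> gr L 0"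
  by (simp add: pth_power_def gr_scale)

lemma brk_pth_power:
  assumes "x \<in> gr L 0" and "y \<in> carr L"
  shows "brk L (pth_power x) y = scl L ((K x x / 2) ^ ((CHAR('a) - 1) div 2)) (brk L x y)"
  using assms by (simp add: pth_power_def brk_scl_left gr_subset_carr')

lemma p_map_pth_power: "p_map (scl L) (brk L) (gr L 0) pth_power"
proof (rule even.p_map_if_centreless[OF prime even.simple_centreless[OF simple] pth_power_closed])
  show "brk L (pth_power x) y = (brk L x ^^ CHAR('a)) y" if "x \<in> gr L 0" "y \<in> gr L 0" for x y
    unfolding even.br_funpow_char[OF odd_char that] using that(1) gr_subset_carr[OF that(2)] by (rule brk_pth_power)
qed

text \<open>The difference of the two values acts as zero on the even part, whose centre is zero.
  Hence every restricted structure is given by the explicit formula.\<close>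

lemma p_map_unique:
  assumes P: "p_map (scl L) (brk L) (gr L 0) P" and x: "x \<in> gr L 0"
  shows "P x = pth_power x"
proof -
  have Px: "P x \<in> gr L 0"
    using P x unfolding p_map_def by blast
  have "P x - pth_power x = 0"
  proof (rule even.simple_centreless[OF simple])
    show "P x - pth_power x \<in> gr L 0"
      using Px x by (simp add: pth_power_closed even.V_intros)
    fix y assume y: "y \<in> gr L 0"
    have "brk L (P x) y = (brk L x ^^ CHAR('a)) y" "brk L (pth_power x) y = (brk L x ^^ CHAR('a)) y"
      using P p_map_pth_power x y unfolding p_map_def by blast+
    moreover have "brk L (P x) y = brk L (P x - pth_power x) y + brk L (pth_power x) y"
      using even.br_add_left[of "P x - pth_power x" "pth_power x" y] Px x y
      by (simp add: pth_power_closed even.V_intros)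
    ultimately show "brk L (P x - pth_power x) y = 0"
      by simp
  qed
  then show ?thesis
    by simp
qed

text \<open>Both computations of the [2p]-map evaluate \<open>P\<close> at a scalar multiple of an
  even element.\<close>

lemma restricted_structure_scale:
  assumes P: "restricted_structure L P" and x: "x \<in> gr L 0"
  shows "P (scl L c x) = scl L (c ^ CHAR('a)) (pth_power x)"
proof -
  have "p_map (scl L) (brk L) (gr L 0) P"
    using P unfolding restricted_structure_def by blast
  then have "P (scl L c x) = scl L (c ^ CHAR('a)) (P x)"
    using x unfolding p_map_def by blast
  also have "P x = pth_power x"
    using \<open>p_map (scl L) (brk L) (gr L 0) P\<close> x by (rule p_map_unique)
  finally show ?thesis .
qed

text \<open>Writing \<open>x = [u, u] / 2\<close>, we have \<open>ad x = (ad u)\<^sup>2\<close> and \<open>ad u x = 0\<close>. Hence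
  \<open>(ad x)\<^sup>3 v - c ad x v\<close> is \<open>ad u\<close> applied to \<open>(ad x)\<^sup>2 y - c y\<close> for the even element
  \<open>y = ad u v\<close>, and this is a multiple of \<open>x\<close>.\<close>

lemma odd_square_cubic:
  fixes u v :: 'b
  defines "x \<equiv> scl L (1 / 2) (brk L u u)"
  assumes u: "u \<in> gr L 1" and v: "v \<in> gr L 1"
  shows "brk L x (brk L x (brk L x v)) = scl L (K x x / 2) (brk L x v)"
proof -
  have x: "x \<in> gr L 0"
    using u by (simp add: x_def brk_closed gr_scale)
  have ad_x: "brk L x z = brk L u (brk L u z)" if "z \<in> gr L i" for z i
    unfolding x_def using two u that by (rule brk_odd_square)
  have ux: "brk L u x = 0"
    unfolding x_def using u brk_odd_cube[OF three u] by (simp add: brk_scl_right gr_subset_carr' brk_closed)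
  define y where "y = brk L u v"
  have y: "y \<in> gr L 0"
    using u v by (simp add: y_def brk_closed)
  have xy: "brk L x y \<in> gr L 0" "brk L x (brk L x y) \<in> gr L 0"
    using x y by (simp_all add: brk_closed)
  obtain b where b: "brk L x (brk L x y) = scl L (K x x / 2) y - scl L b x"
    using even.double_bracket[OF two x y] .
  have xv: "brk L x v = brk L u y"
    using ad_x[OF v] by (simp add: y_def)
  \<comment> \<open>\<open>ad x\<close> is the square of \<open>ad u\<close> and therefore commutes
    with it.\<close>
  have xu: "brk L x (brk L u z) = brk L u (brk L x z)" if "z \<in> gr L 0" for z
    using ad_x[OF brk_closed(2)[OF u that]] ad_x[OF that] by simp
  have "brk L x (brk L x (brk L x v)) = brk L u (brk L x (brk L x y))"
    using y xy by (simp add: xv xu)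
  also have "\<dots> = scl L (K x x / 2) (brk L x v)"
    \<comment> \<open>\<open>ad u\<close> kills \<open>x\<close>, so the unknown coefficient
      \<open>b\<close> disappears.\<close>
    using u x y unfolding b xv
    by (simp add: brk_diff_right brk_scl_right ux gr_subset_carr' gr_scale)
  finally show ?thesis .
qed

theorem restricted_structure_pth_power: "restricted_structure L pth_power"
proof -
  define R where "R = {x \<in> gr L 0. \<forall>m\<in>gr L 1. brk L (pth_power x) m = (brk L x ^^ CHAR('a)) m}"
  have R: "subspace R"
    unfolding R_def using prime two p_map_pth_power by (rule restricted_elements_subspace)
  \<comment> \<open>For half-squares the cubic relation holds on the odd part with the same constant
    as on the even part, so the p-th power of the action is the action of
    \<open>pth_power\<close>.\<close>
  have square: "scl L (1 / 2) (brk L u u) \<in> R" if u: "u \<in> gr L 1" for u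
  proof -
    define x where "x = scl L (1 / 2) (brk L u u)"
    have x: "x \<in> gr L 0"
      using u by (simp add: x_def brk_closed gr_scale)
    have "(brk L x ^^ CHAR('a)) m = scl L ((K x x / 2) ^ ((CHAR('a) - 1) div 2)) (brk L x m)"
      if m: "m \<in> gr L 1" for m
      using x odd_square_cubic[OF u] odd_char m
      by (intro funpow_cubic[of "gr L 1"]) (simp_all add: x_def brk_scl_right gr_subset_carr' brk_closed)
    then have "brk L (pth_power x) m = (brk L x ^^ CHAR('a)) m" if "m \<in> gr L 1" for m
      using x that by (simp add: brk_pth_power gr_subset_carr')
    then show ?thesis
      using x by (simp add: R_def x_def)
  qed
  \<comment> \<open>Polarization: a bracket of two odd elements is a combination of
    half-squares.\<close>
  have "brk L x y \<in> R" if "x \<in> gr L 1" "y \<in> gr L 1" for x y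
  proof -
    let ?q = "\<lambda>u. scl L (1 / 2) (brk L u u)"
    have "brk L (x + y) (x + y) = brk L x x + brk L y y + (brk L x y + brk L x y)"
      using that brk_odd_swap[of x y]
      by (simp add: brk_add_left brk_add_right gr_subset_carr' gr_add algebra_simps)
    then have "?q (x + y) = ?q x + ?q y + scl L (1 / 2 + 1 / 2) (brk L x y)"
      by (simp only: scale_right_distrib scale_left_distrib)
    moreover have "(1 / 2 + 1 / 2 :: 'a) = 1"
      using two by (simp add: field_simps)
    ultimately have "brk L x y = ?q (x + y) - ?q x - ?q y"
      by simp
    then show ?thesis
      using that by (simp only: subspace_diff[OF R] square gr_add)
  qed
  then have "span {brk L x y | x y. x \<in> gr L 1 \<and> y \<in> gr L 1} \<subseteq> R"
    by (intro span_minimal R) auto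
  then have "gr L 0 \<subseteq> R"
    using even_eq_span_odd_brackets[OF simple odd_brk] by simp
  then show ?thesis
    using p_map_pth_power unfolding restricted_structure_def R_def by auto
qed

section \<open>The [2p]-map for osp(1|2) and for the adjoint type\<close>

text \<open>As \<open>p > 3\<close>, a vanishing cube of \<open>ad x\<close> on the even part makes
  the p-th power vanish there too, so \<open>pth_power x\<close> is central in the even
  part.\<close>

lemma pth_power_nilpotent:
  assumes x: "x \<in> gr L 0"
    and nil: "\<And>y. y \<in> gr L 0 \<Longrightarrow> brk L x (brk L x (brk L x y)) = 0"
  shows "pth_power x = 0"
proof (rule even.simple_centreless[OF simple])
  show "pth_power x \<in> gr L 0"
    using x by (rule pth_power_closed)
  fix y assume y: "y \<in> gr L 0"
  have "(brk L x ^^ n) 0 = 0" for n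
    using x by (induction n) (simp_all add: brk_zero gr_subset_carr')
  then have "(brk L x ^^ ((CHAR('a) - 3) + 3)) y = 0"
    unfolding funpow_add o_apply using nil[OF y] by (simp add: numeral_3_eq_3)
  then show "brk L (pth_power x) y = 0"
    using p_map_pth_power x y char unfolding p_map_def by simp
qed

text \<open>The isomorphism sends \<open>[u, u]\<close> to a matrix \<open>N\<close> of square zero
  with no central component. The cube of its adjoint operator vanishes, so its \<open>[p]\<close>-th
  power is zero.\<close>

lemma osp12_two_p_map_zero:
  assumes iso: "iso_salg L (dsum_salg (osp12 :: ('a, ('a^2^2) \<times> ('a^2)) salg) (centre_salg L))"
    and P: "restricted_structure L P" and u: "u \<in> gr L 1"
  shows "two_p_map L P u = 0"
proof -
  let ?S = "dsum_salg (osp12 :: ('a, ('a^2^2) \<times> ('a^2)) salg) (centre_salg L)"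
  obtain f where bij: "bij_betw f (carr L) (carr ?S)"
    and f_gr: "\<And>i. f ` gr L i = gr ?S i"
    and f_add: "\<And>x y. \<lbrakk>x \<in> carr L; y \<in> carr L\<rbrakk> \<Longrightarrow> f (x + y) = f x + f y"
    and f_brk: "\<And>x y. \<lbrakk>x \<in> carr L; y \<in> carr L\<rbrakk> \<Longrightarrow> f (brk L x y) = brk ?S (f x) (f y)"
    using iso unfolding iso_salg_def by metis
  have f_zero: "f 0 = 0"
    using f_add[of 0 0] by (simp add: gr_subset_carr[OF gr_zero])
  define x where "x = brk L u u"
  have x: "x \<in> gr L 0"
    using u by (simp add: x_def brk_closed)
  have f_mem: "f y \<in> gr ?S i" if "y \<in> gr L i" for y i
    using f_gr that by blast
  have even_f: "\<exists>Y z. f y = ((Y, 0), z) \<and> z \<in> centre L" if "y \<in> gr L 0" for y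
    using f_mem[OF that] by (auto simp: dsum_salg_def osp12_def centre_salg_def)
  obtain v z where fu: "f u = ((0, v), z)" "z \<in> centre L"
    using f_mem[OF u] by (auto simp: dsum_salg_def osp12_def centre_salg_def)
  define N where "N = osp_odd_brk v v"
  have centre: "brk L z z' = 0" "brk L 0 z' = 0" if "z \<in> centre L" "z' \<in> centre L" for z z'
    using that by (auto simp: centre_def brk_zero)
  have osp_zero: "osp_odd_brk 0 0 = (0 :: 'a^2^2)"
    by (simp add: osp_odd_brk_def Let_def vec_eq_iff forall_2)
  have fx: "f x = ((N, 0), 0)"
    using f_brk[of u u] u fu centre
    by (simp add: x_def N_def dsum_salg_def osp12_def centre_salg_def gr_subset_carr')
  \<comment> \<open>Brackets with central components vanish, so only the matrix commutator
    survives.\<close>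
  have f_ad: "f (brk L x y) = ((N ** Y - Y ** N, 0), 0)"
    if "y \<in> gr L 0" "f y = ((Y, 0), z)" "z \<in> centre L" for y Y z
    using f_brk[of x y] that x fx centre
    by (simp add: dsum_salg_def osp12_def centre_salg_def gr_subset_carr' osp_zero)
  \<comment> \<open>After the first bracket the central component is 0; its membership in the centre
    lets \<open>f_ad\<close> be iterated.\<close>
  have zero_centre: "0 \<in> centre L"
    by (simp add: centre_def brk_zero gr_subset_carr[OF gr_zero])
  have "brk L x (brk L x (brk L x y)) = 0" if y: "y \<in> gr L 0" for y
  proof -
    obtain Y z where Y: "f y = ((Y, 0), z)" "z \<in> centre L"
      using even_f[OF y] by blast
    define C where "C Y = N ** Y - Y ** N" for Y
    have "f (brk L x (brk L x (brk L x y))) = ((C (C (C Y)), 0), 0)"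
      unfolding C_def
      by (rule f_ad[OF _ f_ad[OF _ f_ad[OF y Y] zero_centre] zero_centre]; intro brk_closed x y)
    also have "\<dots> = f 0"
      using matrix_commutator_cube_zero[OF osp_odd_brk_square_zero[of v], of Y]
      by (simp add: C_def N_def f_zero zero_prod_def)
    finally show ?thesis
      by (rule inj_onD[OF bij_betw_imp_inj_on[OF bij]]; intro gr_subset_carr[of _ 0] gr_zero brk_closed x y)
  qed
  then have "pth_power x = 0"
    by (rule pth_power_nilpotent[OF x])
  then show ?thesis
    unfolding two_p_map_def x_def[symmetric] restricted_structure_scale[OF P x] by simp
qed

text \<open>The odd element \<open>x + a\<close> has square \<open>2 a x\<close>, so its half-square
  is \<open>a x\<close>, and semilinearity turns \<open>a\<close> into its p-th power.\<close>

lemma adjoint_type_two_p_map: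
  assumes \<Phi>: "adjoint_type L \<Phi>" and P: "restricted_structure L P" and x: "x \<in> gr L 0"
  shows "two_p_map L P (\<Phi> (x, a, 0)) = scl L (a ^ CHAR('a)) (pth_power x)"
proof -
  have "0 \<in> centre L"
    by (simp add: centre_def brk_zero gr_subset_carr[OF gr_zero])
  then have "brk L (\<Phi> (x, a, 0)) (\<Phi> (x, a, 0)) = scl L a x + scl L a x"
    using \<Phi> x unfolding adjoint_type_def by blast
  also have "\<dots> = scl L (2 * a) x"
    unfolding scale_left_distrib[symmetric] by simp
  finally have "scl L (1 / 2) (brk L (\<Phi> (x, a, 0)) (\<Phi> (x, a, 0))) = scl L a x"
    using two by simp
  then show ?thesis
    unfolding two_p_map_def using restricted_structure_scale[OF P x] by simp
qed

end

text \<open>The \<open>[p]\<close>-map is not part of the data of \<open>L\<close>: its existence is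
  the first conjunct, and the formulas are asserted for every restricted structure
  \<open>P\<close>.\<close>

theorem corollary6p9:
  fixes L :: "('k::field, 'v::ab_group_add) salg" and p :: nat and K :: "'v \<Rightarrow> 'v \<Rightarrow> 'k"
  assumes "CHAR('k) = p" and "p > 0" and "p \<noteq> 2" and "p \<noteq> 3"
    and "lie_superalgebra L"
    and "finite_dim (scl L) (carr L)"
    and "vector_space.dim (scl L) (gr L 0) = 3"
    and "simple_lie (scl L) (brk L) (gr L 0)"
    and "module.span (scl L) {brk L x y | x y. x \<in> gr L 1 \<and> y \<in> gr L 1} \<noteq> {0}"
    and "K = killing_form (scl L) (brk L) (gr L 0)"
  shows "restricted L \<and>
    (\<forall>P. restricted_structure L P \<longrightarrow>
      (\<forall>x\<in>gr L 0. P x = scl L ((K x x / 2) ^ ((p - 1) div 2)) x) \<and>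
      (\<forall>\<Phi>. adjoint_type L \<Phi> \<longrightarrow>
        (\<forall>x\<in>gr L 0. \<forall>a. two_p_map L P (\<Phi> (x, a, 0))
          = scl L (a ^ p * (K x x / 2) ^ ((p - 1) div 2)) x)) \<and>
      (iso_salg L (dsum_salg (osp12 :: ('k, ('k^2^2) \<times> ('k^2)) salg) (centre_salg L)) \<longrightarrow>
        (\<forall>y\<in>gr L 1. two_p_map L P y = 0)))"
proof -
  interpret L: lie_superalgebra L
    by fact
  have prime: "prime CHAR('k)"
    using assms(1,2) by (intro prime_CHAR_semidom) simp
  then have "CHAR('k) > 3"
    using assms(1-4) prime_ge_2_nat[OF prime] by linarith
  with prime interpret lie_superalgebra_simple_dim3 L
    using assms(7-9) by unfold_locales
  show ?thesis
  proof (intro conjI allI impI ballI)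
    show "restricted L"
      unfolding restricted_def using \<open>CHAR('k) > 3\<close> assms(5) restricted_structure_pth_power by blast
    fix P assume P: "restricted_structure L P"
    then show "P x = scl L ((K x x / 2) ^ ((p - 1) div 2)) x" if "x \<in> gr L 0" for x
      using p_map_unique[of P x] that unfolding restricted_structure_def pth_power_def assms(1,10) by blast
    show "two_p_map L P (\<Phi> (x, a, 0)) = scl L (a ^ p * (K x x / 2) ^ ((p - 1) div 2)) x"
      if "adjoint_type L \<Phi>" "x \<in> gr L 0" for \<Phi> x a
      using adjoint_type_two_p_map[OF that(1) P that(2), of a]
      unfolding pth_power_def assms(1,10) by (simp only: L.scale_scale)
    show "two_p_map L P y = 0"
      if "iso_salg L (dsum_salg (osp12 :: ('k, ('k^2^2) \<times> ('k^2)) salg) (centre_salg L))" "y \<in> gr L 1" for y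
      using that(1) P that(2) by (rule osp12_two_p_map_zero)
  qed
qed

end
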